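(* Let $(X,A)$ be an almost Euclidean compact pair. If every regular cell $C\subseteq X\setminus A$ belongs to a relative cycle, then the cone pair $\mathsf{C}(X,A)$ has the surjection property.
   Context: A compact pair $(X,A)$ consists of a compact metrizable space $X$ and a compact subset $A\subseteq X$. A point $x$ of a space is $n$-Euclidean ($n\geq1$) if it has an open neighborhood homeomorphic to $\mathbb{R}^n$, and Euclidean if it is $n$-Euclidean for some $n\ge1$. A space is almost Euclidean if its Euclidean points are dense. A pair $(X,A)$ is almost Euclidean if $X\setminus A$ is almost Euclidean. Let $\mathbb{B}_n$ be the closed unit ball of $\mathbb{R}^n$ and $\mathbb{S}_{n-1}$ its boundary sphere. For $n\geq1$, a set $C\subseteq X$ is a regular $n$-cell if there is a homeomorphism $f:\mathbb{B}_n\to C$ such that $f(\mathbb{B}_n\setminus\mathbb{S}_{n-1})$ is open in $X$; then $\mathrm{op}(C)=f(\mathbb{B}_n\setminus\mathbb{S}_{n-1})$ is the corresponding open cell. A regular cell is a regular $n$-cell for some $n\ge1$. Let $\mathbb{T}=\mathbb{R}/\mathbb{Z}$. A regular $n$-cell $C\subseteq X\setminus A$ belongs to a relative cycle if the canonical homomorphism $H_n(X,A;\mathbb{T})\to H_n(X,X\setminus\mathrm{op}(C);\mathbb{T})$ (singular homology) is non-trivial. The cone $\mathsf{C}(X)$ is the quotient of $X\times[0,1]$ identifying all points $(x,0)$ (the tip); $X$ is embedded in it as $X\times\{1\}$, and $\mathsf{C}(\emptyset)=\emptyset$. The cone pair is $\mathsf{C}(X,A)=(\mathsf{C}(X),X\cup\mathsf{C}(A))$.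 A pair $(Z,B)$ has the surjection property if every continuous $f:Z\to Z$ with $f|_B=\mathrm{id}_B$ is surjective. *)

theory Defs
  imports "HOL-Analysis.Analysis" "HOL-Homology.Homology"
begin

section \<open>The circle group\<close>

quotient_type circle_group = real / "\<lambda>x y :: real. x - y \<in> \<int>"
proof (rule equivpI)
  show "reflp (\<lambda>x y :: real. x - y \<in> \<int>)"
    by (rule reflpI) simp
  show "symp (\<lambda>x y :: real. x - y \<in> \<int>)"
    by (rule sympI) (metis Ints_minus minus_diff_eq)
  show "transp (\<lambda>x y :: real. x - y \<in> \<int>)"
    by (rule transpI) (metis Ints_add diff_add_cancel add_diff_eq)
qed

instantiation circle_group :: ab_group_add
begin

lift_definition zero_circle_group :: circle_group is 0 .

lift_definition plus_circle_group :: "circle_group \<Rightarrow> circle_group \<Rightarrow> circle_group" is "(+)"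
  by (metis Ints_add add_diff_add)

lift_definition uminus_circle_group :: "circle_group \<Rightarrow> circle_group" is uminus
  by (metis Ints_minus minus_diff_minus)

lift_definition minus_circle_group :: "circle_group \<Rightarrow> circle_group \<Rightarrow> circle_group" is "(-)"
proof -
  fix a b c d :: real
  assume "a - b \<in> \<int>" "c - d \<in> \<int>"
  then have "(a - b) - (c - d) \<in> \<int>"
    by (rule Ints_diff)
  then show "(a - c) - (b - d) \<in> \<int>"
    by (simp add: algebra_simps)
qed

instance
  by standard (transfer; simp add: algebra_simps)+

end


section \<open>Singular homology with coefficients\<close>

text \<open>
  The library builds the singular chain complex with integer coefficients only. Here the
  coefficients range over an arbitrary abelian group; simplices, faces and the indexing conventions
  are those of the library, so that for integer coefficients one gets the library's notions.
\<close>

type_synonym ('a, 'g) coeff_chain = "((nat \<Rightarrow> real) \<Rightarrow> 'a) \<Rightarrow>\<^sub>0 'g"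

definition coeff_singular_chain ::
    "nat \<Rightarrow> 'a topology \<Rightarrow> ('a, 'g::ab_group_add) coeff_chain \<Rightarrow> bool" where
  "coeff_singular_chain p X c \<longleftrightarrow> Poly_Mapping.keys c \<subseteq> singular_simplex_set p X"

definition coeff_simplex_boundary ::
    "nat \<Rightarrow> ((nat \<Rightarrow> real) \<Rightarrow> 'a) \<Rightarrow> 'g \<Rightarrow> ('a, 'g::ab_group_add) coeff_chain" where
  "coeff_simplex_boundary p f g =
     (if p = 0 then 0
      else \<Sum>k\<le>p. Poly_Mapping.single (singular_face p k f) (if even k then g else - g))"

definition coeff_chain_boundary ::
    "nat \<Rightarrow> ('a, 'g::ab_group_add) coeff_chain \<Rightarrow> ('a, 'g) coeff_chain" where
  "coeff_chain_boundary p c =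
     (\<Sum>f\<in>Poly_Mapping.keys c. coeff_simplex_boundary p f (Poly_Mapping.lookup c f))"

definition coeff_relcycle ::
    "nat \<Rightarrow> 'a topology \<Rightarrow> 'a set \<Rightarrow> ('a, 'g::ab_group_add) coeff_chain \<Rightarrow> bool" where
  "coeff_relcycle p X A c \<longleftrightarrow>
     coeff_singular_chain p X c \<and>
     coeff_singular_chain (p - 1) (subtopology X A) (coeff_chain_boundary p c)"

definition coeff_relboundary ::
    "nat \<Rightarrow> 'a topology \<Rightarrow> 'a set \<Rightarrow> ('a, 'g::ab_group_add) coeff_chain \<Rightarrow> bool" where
  "coeff_relboundary p X A c \<longleftrightarrow>
     (\<exists>d. coeff_singular_chain (Suc p) X d \<and>
          coeff_singular_chain p (subtopology X A) (coeff_chain_boundary (Suc p) d - c))"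

definition coeff_relcycle_group ::
    "nat \<Rightarrow> 'a topology \<Rightarrow> 'a set \<Rightarrow> ('a, 'g::ab_group_add) coeff_chain monoid" where
  "coeff_relcycle_group p X A =
     \<lparr>carrier = Collect (coeff_relcycle p X A), monoid.mult = (+), one = 0\<rparr>"

definition coeff_relative_homology_group ::
    "nat \<Rightarrow> 'a topology \<Rightarrow> 'a set \<Rightarrow> ('a, 'g::ab_group_add) coeff_chain set monoid" where
  "coeff_relative_homology_group p X A =
     coeff_relcycle_group p X A Mod Collect (coeff_relboundary p X A)"

text \<open>
  The homomorphism from the homology of \<open>(X, A)\<close> to that of \<open>(X, B)\<close> induced by the inclusion, for
  \<open>A \<subseteq> B\<close>. A homology class is a coset of relative cycles; all its members have the same class modulo
  the relative boundaries of \<open>(X, B)\<close>, see \<open>coeff_hom_inclusion_class\<close> below.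
\<close>

definition coeff_hom_inclusion ::
    "nat \<Rightarrow> 'a topology \<Rightarrow> 'a set \<Rightarrow> 'a set \<Rightarrow>
     ('a, 'g::ab_group_add) coeff_chain set \<Rightarrow> ('a, 'g) coeff_chain set" where
  "coeff_hom_inclusion p X A B K =
     (\<Union>c\<in>K. Collect (coeff_relboundary p X B) #>\<^bsub>coeff_relcycle_group p X B\<^esub> c)"

lemma coeff_singular_chain_0 [simp]: "coeff_singular_chain p X 0"
  by (simp add: coeff_singular_chain_def)

lemma coeff_singular_chain_add:
  "coeff_singular_chain p X a \<Longrightarrow> coeff_singular_chain p X b \<Longrightarrow> coeff_singular_chain p X (a + b)"
  unfolding coeff_singular_chain_def using Poly_Mapping.keys_add[of a b] by blast

lemma coeff_singular_chain_minus:
  "coeff_singular_chain p X (- a) \<longleftrightarrow> coeff_singular_chain p X a"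
  by (simp add: coeff_singular_chain_def in_keys_iff subset_iff)

lemma coeff_singular_chain_diff:
  "coeff_singular_chain p X a \<Longrightarrow> coeff_singular_chain p X b \<Longrightarrow> coeff_singular_chain p X (a - b)"
  using coeff_singular_chain_add[of p X a "- b"] by (simp add: coeff_singular_chain_minus)

lemma coeff_singular_chain_sum:
  "(\<And>i. i \<in> I \<Longrightarrow> coeff_singular_chain p X (f i)) \<Longrightarrow> coeff_singular_chain p X (\<Sum>i\<in>I. f i)"
  by (induction I rule: infinite_finite_induct) (auto intro: coeff_singular_chain_add)

lemma coeff_singular_chain_mono:
  "coeff_singular_chain p (subtopology X A) c \<Longrightarrow> A \<subseteq> B \<Longrightarrow>
   coeff_singular_chain p (subtopology X B) c"
  unfolding coeff_singular_chain_def using singular_simplex_mono by blast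

lemma coeff_singular_chain_subtopology_imp:
  "coeff_singular_chain p (subtopology X A) c \<Longrightarrow> coeff_singular_chain p X c"
  unfolding coeff_singular_chain_def by (auto simp: singular_simplex_subtopology)

lemma coeff_simplex_boundary_0 [simp]: "coeff_simplex_boundary p f 0 = 0"
  by (simp add: coeff_simplex_boundary_def if_cong)

lemma coeff_simplex_boundary_add:
  "coeff_simplex_boundary p f (g + h) =
   coeff_simplex_boundary p f g + coeff_simplex_boundary p f h"
  by (auto simp: coeff_simplex_boundary_def single_add single_diff single_uminus
      simp flip: sum.distrib intro!: sum.cong)

lemma coeff_chain_boundary_superset:
  assumes "finite S" "Poly_Mapping.keys c \<subseteq> S"
  shows "coeff_chain_boundary p c =
         (\<Sum>f\<in>S. coeff_simplex_boundary p f (Poly_Mapping.lookup c f))"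
  unfolding coeff_chain_boundary_def
  by (rule sum.mono_neutral_left) (use assms in \<open>auto simp: in_keys_iff\<close>)

lemma coeff_chain_boundary_0 [simp]: "coeff_chain_boundary p 0 = 0"
  by (simp add: coeff_chain_boundary_def)

lemma coeff_chain_boundary_single [simp]:
  "coeff_chain_boundary p (Poly_Mapping.single f g) = coeff_simplex_boundary p f g"
  by (subst coeff_chain_boundary_superset[of "{f}"]) auto

lemma coeff_chain_boundary_add:
  "coeff_chain_boundary p (a + b) = coeff_chain_boundary p a + coeff_chain_boundary p b"
proof -
  let ?S = "Poly_Mapping.keys a \<union> Poly_Mapping.keys b"
  show ?thesis
    using Poly_Mapping.keys_add[of a b]
    by (simp add: coeff_chain_boundary_superset[of ?S] lookup_add coeff_simplex_boundary_add
        sum.distrib)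
qed

lemma coeff_chain_boundary_minus:
  "coeff_chain_boundary p (- a) = - coeff_chain_boundary p a"
  using coeff_chain_boundary_add[of p a "- a"] by (simp add: eq_neg_iff_add_eq_0 add.commute)

lemma coeff_chain_boundary_diff:
  "coeff_chain_boundary p (a - b) = coeff_chain_boundary p a - coeff_chain_boundary p b"
  using coeff_chain_boundary_add[of p a "- b"] by (simp add: coeff_chain_boundary_minus)

lemma coeff_chain_boundary_sum:
  "coeff_chain_boundary p (\<Sum>i\<in>I. f i) = (\<Sum>i\<in>I. coeff_chain_boundary p (f i))"
  by (induction I rule: infinite_finite_induct) (auto simp: coeff_chain_boundary_add)

lemma coeff_singular_chain_boundary:
  assumes "coeff_singular_chain p X c"
  shows "coeff_singular_chain (p - 1) X (coeff_chain_boundary p c)"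
proof -
  have "coeff_singular_chain (p - 1) X (coeff_simplex_boundary p f g)"
    if "singular_simplex p X f" for f and g :: 'b
    using singular_simplex_singular_face[OF that]
    by (auto simp: coeff_simplex_boundary_def coeff_singular_chain_def[of _ _ "Poly_Mapping.single _ _"]
        intro!: coeff_singular_chain_sum)
  then show ?thesis
    using assms unfolding coeff_chain_boundary_def
    by (intro coeff_singular_chain_sum) (auto simp: coeff_singular_chain_def)
qed

lemma coeff_simplex_boundary_boundary:
  "coeff_chain_boundary (p - 1) (coeff_simplex_boundary p f g) = 0"
proof (cases "p \<le> 1")
  case True
  then show ?thesis
    by (auto simp: coeff_simplex_boundary_def coeff_chain_boundary_def)
next
  case False
  have eql: "{..p} \<times> {..p - 1} \<inter> {(x, y). y < x} = (\<lambda>(j,i). (Suc i, j)) ` {(i,j). i \<le> j \<and> j \<le> p - 1}"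
    using False
    by (auto simp: image_def) (metis One_nat_def diff_Suc_1 diff_le_mono le_refl lessE less_imp_le_nat)
  have eqr: "{..p} \<times> {..p - 1} - {(x, y). y < x} = {(i,j). i \<le> j \<and> j \<le> p - 1}"
    by auto
  have eqf: "singular_face (p - 1) i (singular_face p (Suc j) f) =
             singular_face (p - 1) j (singular_face p i f)" if "i \<le> j" "j \<le> p - 1" for i j
  proof (rule ext)
    fix t
    show "singular_face (p - 1) i (singular_face p (Suc j) f) t =
          singular_face (p - 1) j (singular_face p i f) t"
    proof (cases "t \<in> standard_simplex (p - 1 - 1)")
      case True
      have fi: "simplical_face i t \<in> standard_simplex (p - Suc 0)"
        using False True simplical_face_in_standard_simplex that by force
      have fj: "simplical_face j t \<in> standard_simplex (p - Suc 0)"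
        using False True simplical_face_in_standard_simplex[of "p - 1" j t] that by force
      have eq: "simplical_face (Suc j) (simplical_face i t) = simplical_face i (simplical_face j t)"
        using True that unfolding standard_simplex_def simplical_face_def by fastforce
      show ?thesis by (simp add: singular_face_def fi fj eq)
    qed (simp add: singular_face_def)
  qed
  define F where "F x i = Poly_Mapping.single (singular_face (p - 1) i (singular_face p x f))
    (if even (x + i) then g else - g)" for x i
  have "coeff_chain_boundary (p - 1) (coeff_simplex_boundary p f g) = (\<Sum>x\<le>p. \<Sum>i\<le>p - 1. F x i)"
    using False
    by (auto simp: coeff_simplex_boundary_def coeff_chain_boundary_sum F_def intro!: sum.cong)
  also have "\<dots> = (\<Sum>(x,i)\<in>{(i,j). i \<le> j \<and> j \<le> p - 1}. F (Suc i) x) +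
                 (\<Sum>(x,i)\<in>{(i,j). i \<le> j \<and> j \<le> p - 1}. F x i)"
    apply (simp add: sum.cartesian_product sum.Int_Diff [of "_ \<times> _" _ "{(x,y). y < x}"] del: One_nat_def)
    unfolding eql eqr
    apply (simp add: sum.reindex inj_on_def case_prod_unfold del: One_nat_def)
    done
  also have "\<dots> = 0"
    by (simp flip: sum.distrib add: case_prod_unfold del: One_nat_def)
       (rule sum.neutral, auto simp: F_def eqf[unfolded One_nat_def] simp flip: single_add)
  finally show ?thesis .
qed

lemma coeff_chain_boundary_boundary [simp]:
  "coeff_chain_boundary (p - 1) (coeff_chain_boundary p c) = 0"
  by (subst (2) coeff_chain_boundary_def)
     (simp add: coeff_chain_boundary_sum coeff_simplex_boundary_boundary del: One_nat_def)

lemma coeff_relcycle_0: "coeff_relcycle p X A 0"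
  by (simp add: coeff_relcycle_def)

lemma coeff_relcycle_add:
  "coeff_relcycle p X A a \<Longrightarrow> coeff_relcycle p X A b \<Longrightarrow> coeff_relcycle p X A (a + b)"
  by (simp add: coeff_relcycle_def coeff_chain_boundary_add coeff_singular_chain_add)

lemma coeff_relcycle_minus: "coeff_relcycle p X A a \<Longrightarrow> coeff_relcycle p X A (- a)"
  by (simp add: coeff_relcycle_def coeff_chain_boundary_minus coeff_singular_chain_minus)

lemma coeff_relcycle_mono: "coeff_relcycle p X A c \<Longrightarrow> A \<subseteq> B \<Longrightarrow> coeff_relcycle p X B c"
  unfolding coeff_relcycle_def using coeff_singular_chain_mono by blast

lemma coeff_relboundary_0: "coeff_relboundary p X A 0"
  unfolding coeff_relboundary_def by (rule exI[of _ 0]) simp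

lemma coeff_relboundary_add:
  assumes "coeff_relboundary p X A a" "coeff_relboundary p X A b"
  shows "coeff_relboundary p X A (a + b)"
proof -
  obtain d e where "coeff_singular_chain (Suc p) X d" "coeff_singular_chain (Suc p) X e"
    "coeff_singular_chain p (subtopology X A) (coeff_chain_boundary (Suc p) d - a)"
    "coeff_singular_chain p (subtopology X A) (coeff_chain_boundary (Suc p) e - b)"
    using assms unfolding coeff_relboundary_def by blast
  moreover from this have "coeff_singular_chain p (subtopology X A)
      (coeff_chain_boundary (Suc p) (d + e) - (a + b))"
    using coeff_singular_chain_add
    by (metis add_diff_add coeff_chain_boundary_add)
  ultimately show ?thesis
    unfolding coeff_relboundary_def using coeff_singular_chain_add by blast
qed

lemma coeff_relboundary_minus:
  assumes "coeff_relboundary p X A a"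
  shows "coeff_relboundary p X A (- a)"
proof -
  obtain d where "coeff_singular_chain (Suc p) X d"
    "coeff_singular_chain p (subtopology X A) (coeff_chain_boundary (Suc p) d - a)"
    using assms unfolding coeff_relboundary_def by blast
  then have "coeff_singular_chain (Suc p) X (- d)"
    "coeff_singular_chain p (subtopology X A) (coeff_chain_boundary (Suc p) (- d) - (- a))"
    by (metis coeff_chain_boundary_minus coeff_singular_chain_minus minus_diff_minus)+
  then show ?thesis
    unfolding coeff_relboundary_def by blast
qed

lemma coeff_relboundary_mono:
  "coeff_relboundary p X A c \<Longrightarrow> A \<subseteq> B \<Longrightarrow> coeff_relboundary p X B c"
  unfolding coeff_relboundary_def using coeff_singular_chain_mono by blast

lemma coeff_relboundary_imp_relcycle:
  assumes "coeff_relboundary p X A c"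
  shows "coeff_relcycle p X A c"
proof -
  obtain d where d: "coeff_singular_chain (Suc p) X d"
    and s: "coeff_singular_chain p (subtopology X A) (coeff_chain_boundary (Suc p) d - c)"
    using assms unfolding coeff_relboundary_def by blast
  define e where "e = coeff_chain_boundary (Suc p) d - c"
  have c: "c = coeff_chain_boundary (Suc p) d - e"
    by (simp add: e_def)
  have e: "coeff_singular_chain p (subtopology X A) e"
    using s by (simp add: e_def)
  have "coeff_singular_chain p X c"
    unfolding c using coeff_singular_chain_boundary[OF d] coeff_singular_chain_subtopology_imp[OF e]
    by (auto intro: coeff_singular_chain_diff)
  moreover have "coeff_chain_boundary p c = - coeff_chain_boundary p e"
    using coeff_chain_boundary_boundary[of "Suc p" d] by (simp add: c coeff_chain_boundary_diff)
  ultimately show ?thesis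
    using coeff_singular_chain_boundary[OF e]
    by (simp add: coeff_relcycle_def coeff_singular_chain_minus)
qed

lemma comm_group_coeff_relcycle_group: "comm_group (coeff_relcycle_group p X A)"
proof (rule comm_groupI)
  fix x assume "x \<in> carrier (coeff_relcycle_group p X A)"
  then show "\<exists>y\<in>carrier (coeff_relcycle_group p X A).
      y \<otimes>\<^bsub>coeff_relcycle_group p X A\<^esub> x = \<one>\<^bsub>coeff_relcycle_group p X A\<^esub>"
    by (intro bexI[of _ "- x"]) (auto simp: coeff_relcycle_group_def coeff_relcycle_minus)
qed (auto simp: coeff_relcycle_group_def coeff_relcycle_0 coeff_relcycle_add algebra_simps)

lemma normal_coeff_relboundary:
  "Collect (coeff_relboundary p X A) \<lhd> coeff_relcycle_group p X A"
proof -
  interpret comm_group "coeff_relcycle_group p X A"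
    by (rule comm_group_coeff_relcycle_group)
  have inv: "inv\<^bsub>coeff_relcycle_group p X A\<^esub> a = - a" if "coeff_relcycle p X A a" for a
    by (rule inv_equality) (use that in \<open>auto simp: coeff_relcycle_group_def coeff_relcycle_minus\<close>)
  have "subgroup (Collect (coeff_relboundary p X A)) (coeff_relcycle_group p X A)"
  proof (rule subgroupI)
    fix a assume "a \<in> Collect (coeff_relboundary p X A)"
    then show "inv\<^bsub>coeff_relcycle_group p X A\<^esub> a \<in> Collect (coeff_relboundary p X A)"
      by (simp add: inv coeff_relboundary_imp_relcycle coeff_relboundary_minus)
  qed (use coeff_relboundary_0 in
        \<open>auto simp: coeff_relcycle_group_def coeff_relboundary_imp_relcycle coeff_relboundary_add\<close>)
  then show ?thesis
    by (simp add: normal_iff_subgroup)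
qed

lemma group_coeff_relative_homology_group:
  "group (coeff_relative_homology_group p X A)"
  unfolding coeff_relative_homology_group_def
  by (rule normal.factorgroup_is_group[OF normal_coeff_relboundary])

lemma coeff_relboundary_coset:
  "Collect (coeff_relboundary p X A) #>\<^bsub>coeff_relcycle_group p X A\<^esub> c =
   {c'. coeff_relboundary p X A (c' - c)}"
  by (force simp: r_coset_def coeff_relcycle_group_def)

lemma carrier_coeff_relative_homology_group:
  "carrier (coeff_relative_homology_group p X A) =
   (\<lambda>c. Collect (coeff_relboundary p X A) #>\<^bsub>coeff_relcycle_group p X A\<^esub> c) `
     Collect (coeff_relcycle p X A)"
proof -
  have "carrier (coeff_relcycle_group p X A) = Collect (coeff_relcycle p X A)"
    by (simp add: coeff_relcycle_group_def)
  then show ?thesis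
    by (auto simp: coeff_relative_homology_group_def FactGroup_def RCOSETS_def)
qed

lemma coeff_hom_inclusion_class:
  assumes "A \<subseteq> B"
  shows "coeff_hom_inclusion p X A B
           (Collect (coeff_relboundary p X A) #>\<^bsub>coeff_relcycle_group p X A\<^esub> c) =
         Collect (coeff_relboundary p X B) #>\<^bsub>coeff_relcycle_group p X B\<^esub> c"
proof -
  have "coeff_relboundary p X B (e - c)"
    if "coeff_relboundary p X A (d - c)" "coeff_relboundary p X B (e - d)" for d e
    using coeff_relboundary_add[OF that(2) coeff_relboundary_mono[OF that(1) assms]] by simp
  moreover have "coeff_relboundary p X A (c - c)"
    by (simp add: coeff_relboundary_0)
  ultimately show ?thesis
    unfolding coeff_hom_inclusion_def coeff_relboundary_coset by blast
qed

lemma coeff_hom_inclusion_hom: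
  assumes "A \<subseteq> B"
  shows "(coeff_hom_inclusion p X A B ::
           ('a, 'g::ab_group_add) coeff_chain set \<Rightarrow> ('a, 'g) coeff_chain set) \<in>
         hom (coeff_relative_homology_group p X A) (coeff_relative_homology_group p X B)"
proof (rule homI)
  fix x assume "x \<in> carrier (coeff_relative_homology_group p X A)"
  then obtain c where c: "coeff_relcycle p X A c"
    "x = Collect (coeff_relboundary p X A) #>\<^bsub>coeff_relcycle_group p X A\<^esub> c"
    by (auto simp: carrier_coeff_relative_homology_group)
  then show "coeff_hom_inclusion p X A B x \<in> carrier (coeff_relative_homology_group p X B)"
    using coeff_relcycle_mono[OF c(1) assms]
    by (auto simp: coeff_hom_inclusion_class[OF assms] carrier_coeff_relative_homology_group)
next
  fix x y :: "('a, 'g) coeff_chain set"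
  assume "x \<in> carrier (coeff_relative_homology_group p X A)"
    and "y \<in> carrier (coeff_relative_homology_group p X A)"
  then obtain c d where c: "coeff_relcycle p X A c" and d: "coeff_relcycle p X A d"
    and x: "x = Collect (coeff_relboundary p X A) #>\<^bsub>coeff_relcycle_group p X A\<^esub> c"
    and y: "y = Collect (coeff_relboundary p X A) #>\<^bsub>coeff_relcycle_group p X A\<^esub> d"
    by (auto simp: carrier_coeff_relative_homology_group)
  have *: "(Collect (coeff_relboundary p X S) #>\<^bsub>coeff_relcycle_group p X S\<^esub> c)
        \<otimes>\<^bsub>coeff_relative_homology_group p X S\<^esub>
      (Collect (coeff_relboundary p X S) #>\<^bsub>coeff_relcycle_group p X S\<^esub> d) =
      Collect (coeff_relboundary p X S) #>\<^bsub>coeff_relcycle_group p X S\<^esub> (c + d)"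
    if "A \<subseteq> S" for S
    using normal.rcos_sum[OF normal_coeff_relboundary, of c p X S d]
      coeff_relcycle_mono[OF c that] coeff_relcycle_mono[OF d that]
    by (simp add: coeff_relative_homology_group_def FactGroup_def coeff_relcycle_group_def)
  show "coeff_hom_inclusion p X A B (x \<otimes>\<^bsub>coeff_relative_homology_group p X A\<^esub> y) =
      coeff_hom_inclusion p X A B x \<otimes>\<^bsub>coeff_relative_homology_group p X B\<^esub>
      coeff_hom_inclusion p X A B y"
    using assms by (simp add: x y * coeff_hom_inclusion_class)
qed


section \<open>Compact pairs and Euclidean points\<close>

definition compact_pair :: "'a topology \<Rightarrow> 'a set \<Rightarrow> bool" where
  "compact_pair X A \<longleftrightarrow> compact_space X \<and> metrizable_space X \<and> compactin X A"

definition n_Euclidean_point :: "nat \<Rightarrow> 'a topology \<Rightarrow> 'a \<Rightarrow> bool" where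
  "n_Euclidean_point n Y x \<longleftrightarrow>
     n \<ge> 1 \<and> (\<exists>U. openin Y U \<and> x \<in> U \<and> subtopology Y U homeomorphic_space Euclidean_space n)"

definition Euclidean_point :: "'a topology \<Rightarrow> 'a \<Rightarrow> bool" where
  "Euclidean_point Y x \<longleftrightarrow> (\<exists>n\<ge>1. n_Euclidean_point n Y x)"

definition almost_Euclidean_space :: "'a topology \<Rightarrow> bool" where
  "almost_Euclidean_space Y \<longleftrightarrow> Y closure_of {x \<in> topspace Y. Euclidean_point Y x} = topspace Y"

definition almost_Euclidean_pair :: "'a topology \<Rightarrow> 'a set \<Rightarrow> bool" where
  "almost_Euclidean_pair X A \<longleftrightarrow> almost_Euclidean_space (subtopology X (topspace X - A))"


section \<open>Regular cells\<close>

definition unit_ball :: "nat \<Rightarrow> (nat \<Rightarrow> real) topology" where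
  "unit_ball n = subtopology (Euclidean_space n) {x. (\<Sum>i<n. x i ^ 2) \<le> 1}"

text \<open>
  The boundary sphere of the \<open>n\<close>-ball is \<open>nsphere (n - 1)\<close> for \<open>n \<ge> 1\<close>, in the same coordinates.
\<close>

definition open_unit_ball :: "nat \<Rightarrow> (nat \<Rightarrow> real) set" where
  "open_unit_ball n = topspace (unit_ball n) - topspace (nsphere (n - 1))"

definition regular_cell_map :: "nat \<Rightarrow> 'a topology \<Rightarrow> 'a set \<Rightarrow> ((nat \<Rightarrow> real) \<Rightarrow> 'a) \<Rightarrow> bool" where
  "regular_cell_map n X C f \<longleftrightarrow>
     homeomorphic_map (unit_ball n) (subtopology X C) f \<and> openin X (f ` open_unit_ball n)"

definition regular_n_cell :: "nat \<Rightarrow> 'a topology \<Rightarrow> 'a set \<Rightarrow> bool" where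
  "regular_n_cell n X C \<longleftrightarrow> n \<ge> 1 \<and> C \<subseteq> topspace X \<and> (\<exists>f. regular_cell_map n X C f)"

text \<open>The open cell does not depend on the parametrization, see \<open>open_cell_eq\<close> below.\<close>

definition open_cell :: "nat \<Rightarrow> 'a topology \<Rightarrow> 'a set \<Rightarrow> 'a set" where
  "open_cell n X C = (THE U. \<exists>f. regular_cell_map n X C f \<and> U = f ` open_unit_ball n)"

definition belongs_to_relative_cycle :: "nat \<Rightarrow> 'a topology \<Rightarrow> 'a set \<Rightarrow> 'a set \<Rightarrow> bool" where
  "belongs_to_relative_cycle n X A C \<longleftrightarrow>
     (let B = topspace X - open_cell n X C;
          H = (coeff_relative_homology_group n X A :: ('a, circle_group) coeff_chain set monoid)
      in \<exists>K\<in>carrier H.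
           coeff_hom_inclusion n X A B K \<noteq> \<one>\<^bsub>coeff_relative_homology_group n X B\<^esub>)"

lemma open_unit_ball_eq:
  assumes "n \<ge> 1"
  shows "open_unit_ball n = {x \<in> topspace (Euclidean_space n). (\<Sum>i<n. x i ^ 2) < 1}"
proof -
  have "{..n - 1} = {..<n}"
    using assms by auto
  then show ?thesis
    using assms
    by (auto simp: open_unit_ball_def unit_ball_def nsphere_def topspace_Euclidean_space)
qed

lemma openin_open_unit_ball:
  assumes "n \<ge> 1"
  shows "openin (Euclidean_space n) (open_unit_ball n)"
proof -
  have "continuous_map (Euclidean_space n) euclideanreal (\<lambda>x. \<Sum>i<n. x i ^ 2)"
    unfolding Euclidean_space_def
    by (intro continuous_map_from_subtopology continuous_map_sum continuous_map_real_pow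
        continuous_map_product_projection) auto
  from openin_continuous_map_preimage[OF this, of "{..<1}"] show ?thesis
    by (simp add: open_unit_ball_eq[OF assms])
qed

lemma open_subset_unit_ball:
  assumes n: "n \<ge> 1" and V: "openin (Euclidean_space n) V" "V \<subseteq> topspace (unit_ball n)"
  shows "V \<subseteq> open_unit_ball n"
proof
  fix x assume x: "x \<in> V"
  let ?s = "\<lambda>t i. t * x i :: real"
  have xE: "x \<in> topspace (Euclidean_space n)"
    using V x openin_subset by blast
  have cont: "continuous_map euclideanreal (Euclidean_space n) ?s"
    using xE unfolding Euclidean_space_def
    by (auto simp: continuous_map_in_subtopology continuous_map_componentwise_UNIV
        intro!: continuous_intros)
  have "open {t. ?s t \<in> V}"
    using openin_continuous_map_preimage[OF cont V(1)] by simp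
  moreover have "1 \<in> {t. ?s t \<in> V}"
    using x by simp
  ultimately obtain e where e: "e > 0" "\<And>t. dist t 1 < e \<Longrightarrow> ?s t \<in> V"
    unfolding open_dist by blast
  define t where "t = 1 + e / 2"
  have "?s t \<in> V"
    using e by (intro e(2)) (auto simp: t_def dist_real_def)
  then have "(\<Sum>i<n. (t * x i)\<^sup>2) \<le> 1"
    using V(2) by (auto simp: unit_ball_def)
  then have le: "t\<^sup>2 * (\<Sum>i<n. (x i)\<^sup>2) \<le> 1"
    by (simp add: power_mult_distrib sum_distrib_left)
  have t: "t\<^sup>2 > 1"
    using e(1) by (simp add: t_def)
  have "(\<Sum>i<n. (x i)\<^sup>2) < 1"
  proof (rule ccontr)
    assume "\<not> (\<Sum>i<n. (x i)\<^sup>2) < 1"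
    then have "t\<^sup>2 * 1 \<le> t\<^sup>2 * (\<Sum>i<n. (x i)\<^sup>2)"
      by (intro mult_left_mono) auto
    then show False
      using le t by linarith
  qed
  then show "x \<in> open_unit_ball n"
    using xE by (simp add: open_unit_ball_eq[OF n])
qed

lemma regular_cell_map_image_subset:
  assumes n: "n \<ge> 1" and f: "regular_cell_map n X C f" and g: "regular_cell_map n X C g"
  shows "f ` open_unit_ball n \<subseteq> g ` open_unit_ball n"
proof -
  let ?B = "unit_ball n" and ?I = "open_unit_ball n" and ?E = "Euclidean_space n"
  have hf: "homeomorphic_map ?B (subtopology X C) f" and hg: "homeomorphic_map ?B (subtopology X C) g"
    using f g by (auto simp: regular_cell_map_def)
  obtain g' where g': "homeomorphic_maps ?B (subtopology X C) g g'"
    using hg homeomorphic_map_maps by blast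
  have I: "?I \<subseteq> topspace ?B"
    by (auto simp: open_unit_ball_def)
  have "homeomorphic_map (subtopology X C) ?B g'"
    using g' homeomorphic_maps_map by blast
  then have h: "homeomorphic_map ?B ?B (g' \<circ> f)"
    using hf homeomorphic_map_compose by blast
  have "continuous_map (subtopology ?E ?I) ?E (g' \<circ> f)"
  proof -
    have "{x. (\<Sum>i<n. x i ^ 2) \<le> 1} \<inter> ?I = ?I"
      using I by (auto simp: unit_ball_def)
    then have "subtopology ?E ?I = subtopology ?B ?I"
      by (simp add: unit_ball_def subtopology_subtopology)
    then have "continuous_map (subtopology ?E ?I) ?B (g' \<circ> f)"
      by (metis continuous_map_from_subtopology h homeomorphic_imp_continuous_map)
    then show ?thesis
      unfolding unit_ball_def by (rule continuous_map_into_fulltopology)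
  qed
  moreover have "inj_on (g' \<circ> f) ?I"
    using h I homeomorphic_imp_injective_map inj_on_subset by blast
  ultimately have "openin ?E ((g' \<circ> f) ` ?I)"
    using invariance_of_domain_Euclidean_space openin_open_unit_ball[OF n] by blast
  moreover have "(g' \<circ> f) ` ?I \<subseteq> topspace ?B"
    using h I homeomorphic_imp_surjective_map by blast
  ultimately have sub: "(g' \<circ> f) ` ?I \<subseteq> ?I"
    using open_subset_unit_ball[OF n] by blast
  show ?thesis
  proof
    fix y assume "y \<in> f ` ?I"
    then obtain x where x: "x \<in> ?I" "y = f x"
      by blast
    then have "y \<in> topspace (subtopology X C)"
      using hf I homeomorphic_imp_surjective_map by blast
    then have "g (g' y) = y"
      using g' unfolding homeomorphic_maps_def by blast
    moreover have "g' y \<in> ?I"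
      using sub x by auto
    ultimately show "y \<in> g ` ?I"
      by force
  qed
qed

lemma open_cell_eq:
  assumes "n \<ge> 1" "regular_cell_map n X C f"
  shows "open_cell n X C = f ` open_unit_ball n"
  unfolding open_cell_def
  by (rule the_equality) (use assms regular_cell_map_image_subset in blast)+


section \<open>Cones\<close>

text \<open>
  Points of the cone are the equivalence classes, as subsets of \<open>X \<times> [0,1]\<close>, and its topology is the
  quotient topology. There is no tip if \<open>X\<close> is empty.
\<close>

definition cone_proj :: "'a topology \<Rightarrow> 'a \<times> real \<Rightarrow> ('a \<times> real) set" where
  "cone_proj X = (\<lambda>(x, t). if t = 0 then topspace X \<times> {0} else {(x, t)})"

definition cylinder :: "'a topology \<Rightarrow> ('a \<times> real) topology" where
  "cylinder X = prod_topology X (top_of_set {0..1})"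

definition cone :: "'a topology \<Rightarrow> ('a \<times> real) set topology" where
  "cone X = topology (\<lambda>U. U \<subseteq> cone_proj X ` topspace (cylinder X) \<and>
                          openin (cylinder X) {z \<in> topspace (cylinder X). cone_proj X z \<in> U})"

definition cone_base :: "'a topology \<Rightarrow> ('a \<times> real) set set" where
  "cone_base X = cone_proj X ` (topspace X \<times> {1})"

definition subcone :: "'a topology \<Rightarrow> 'a set \<Rightarrow> ('a \<times> real) set set" where
  "subcone X A = cone_proj X ` (A \<times> {0..1})"

definition cone_pair :: "'a topology \<Rightarrow> 'a set \<Rightarrow> ('a \<times> real) set topology \<times> ('a \<times> real) set set" where
  "cone_pair X A = (cone X, cone_base X \<union> subcone X A)"

definition surjection_property :: "'b topology \<times> 'b set \<Rightarrow> bool" where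
  "surjection_property = (\<lambda>(Z, B).
     \<forall>f. continuous_map Z Z f \<and> (\<forall>z\<in>B. f z = z) \<longrightarrow> f ` topspace Z = topspace Z)"

lemma openin_cone:
  "openin (cone X) U \<longleftrightarrow> U \<subseteq> cone_proj X ` topspace (cylinder X) \<and>
     openin (cylinder X) {z \<in> topspace (cylinder X). cone_proj X z \<in> U}"
proof -
  let ?P = "\<lambda>U. {z \<in> topspace (cylinder X). cone_proj X z \<in> U}"
  have "?P (S \<inter> T) = ?P S \<inter> ?P T" "?P (\<Union>\<U>) = (\<Union>U\<in>\<U>. ?P U)" for S T \<U>
    by auto
  then have "istopology (\<lambda>U. U \<subseteq> cone_proj X ` topspace (cylinder X) \<and> openin (cylinder X) (?P U))"
    unfolding istopology_def by (auto simp del: Union_iff)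
  then show ?thesis
    by (simp add: cone_def topology_inverse')
qed

lemma quotient_map_cone_proj: "quotient_map (cylinder X) (cone X) (cone_proj X)"
proof -
  have "topspace (cone X) = cone_proj X ` topspace (cylinder X)"
  proof
    show "topspace (cone X) \<subseteq> cone_proj X ` topspace (cylinder X)"
      using openin_cone[of X "topspace (cone X)"] by simp
    have "openin (cone X) (cone_proj X ` topspace (cylinder X))"
      by (subst openin_cone) (auto simp: image_iff intro: back_subst[of "openin _", OF openin_topspace])
    then show "cone_proj X ` topspace (cylinder X) \<subseteq> topspace (cone X)"
      by (rule openin_subset)
  qed
  then show ?thesis
    by (auto simp: quotient_map_def openin_cone)
qed

end

theory Submission
  imports Defs
begin

text \<open>
  Suppose that a map \<open>f\<close> of the cone fixes the base and the subcone over \<open>A\<close> but is not surjective. Its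
  image is compact, so it misses an open set. That set contains a product \<open>C \<times> {t}\<close> with \<open>0 < t < 1\<close> and
  \<open>C \<subseteq> X - A\<close> a small regular \<open>n\<close>-cell, because the Euclidean points are dense in \<open>X - A\<close>. A relative
  cycle \<open>c\<close> of \<open>(X, A)\<close> to which \<open>C\<close> belongs then leads to a contradiction, as follows.

  The cone over \<open>c\<close> is a chain with boundary \<open>c\<close> up to a chain in the subcone over \<open>A\<close>, and since \<open>f\<close> fixes the
  base and preserves that subcone, the same holds for the image \<open>e\<close> of the cone under \<open>f\<close>. Now \<open>e\<close> avoids
  \<open>C \<times> {t}\<close>. It therefore lies in the union of the open set \<open>U\<close> of the points above level \<open>t\<close> or over the
  complement of \<open>C\<close> (the tip excluded) and the open set \<open>V\<close> of the points below level \<open>t\<close>. By excision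
  (\<open>coeff_relboundary_excision\<close>), \<open>c\<close> bounds in \<open>U\<close> modulo the part of \<open>U\<close> that lies in \<open>V\<close> or in the
  subcone. The projection of the cone to \<open>X\<close> is defined on \<open>U\<close> and maps that part into \<open>X - C\<close>, because \<open>C\<close> is
  disjoint from \<open>A\<close>. Hence \<open>c\<close> bounds in \<open>X\<close> modulo \<open>X - C\<close> (\<open>coeff_relboundary_of_cone_map\<close>), and a fortiori
  modulo the complement of the open cell, contradicting the choice of \<open>c\<close>.

  Chains here have coefficients in an arbitrary abelian group. The subdivision operators, their chain homotopy to the
  identity and the cone operator are first considered on integral chains and then tensored with the
  coefficient group (\<open>coeff_lift\<close>).
\<close>

section \<open>Change of coefficients for chain operators\<close>

text \<open>One of the two sums is empty, depending on the sign of \<open>k\<close>.\<close>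

definition int_scale :: "int \<Rightarrow> 'g::ab_group_add \<Rightarrow> 'g" where
  "int_scale k g = (\<Sum>i<nat k. g) - (\<Sum>i<nat (- k). g)"

lemma sum_constant_add:
  fixes g :: "'g::comm_monoid_add"
  shows "(\<Sum>i<a + b. g) = (\<Sum>i<a. g) + (\<Sum>i<b::nat. g)"
  by (induction b) (simp_all add: add.assoc)

lemma int_scale_int_diff:
  fixes g :: "'g::ab_group_add"
  shows "int_scale (int m - int n) g = (\<Sum>i<m. g) - (\<Sum>i<n. g)"
proof -
  show ?thesis
  proof (cases "n \<le> m")
    case True
    then obtain k where "m = n + k"
      using le_Suc_ex by blast
    then show ?thesis
      by (simp add: int_scale_def sum_constant_add)
  next
    case False
    then obtain k where "n = m + k"
      using le_Suc_ex nat_le_linear by blast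
    then show ?thesis
      by (simp add: int_scale_def sum_constant_add)
  qed
qed

lemma int_scale_0 [simp]: "int_scale 0 g = 0"
  and int_scale_1 [simp]: "int_scale 1 g = g"
  by (simp_all add: int_scale_def)

lemma int_scale_add: "int_scale k (g + h) = int_scale k g + int_scale k h"
  by (simp add: int_scale_def sum.distrib)

lemma int_scale_diff_left: "int_scale (k - l) g = int_scale k g - int_scale l g"
proof -
  obtain a b c d where "k = int a - int b" "l = int c - int d"
    using int_diff_cases by metis
  moreover have "int a - int b - (int c - int d) = int (a + d) - int (b + c)"
    by simp
  ultimately show ?thesis
    by (simp only: int_scale_int_diff sum_constant_add) (simp add: algebra_simps)
qed

text \<open>The image of \<open>c \<otimes> g\<close> under the identification of chains with coefficients in a group \<open>G\<close> with
  the tensor product of the integral chains and \<open>G\<close>.\<close>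

definition coeff_tensor :: "'a chain \<Rightarrow> 'g::ab_group_add \<Rightarrow> ('a, 'g) coeff_chain" where
  "coeff_tensor c g = Poly_Mapping.map (\<lambda>k. int_scale k g) c"

lemma lookup_coeff_tensor:
  "Poly_Mapping.lookup (coeff_tensor c g) f = int_scale (Poly_Mapping.lookup c f) g"
  by (simp add: coeff_tensor_def map.rep_eq when_def)

lemma coeff_tensor_0 [simp]: "coeff_tensor 0 g = 0"
  by (simp add: poly_mapping_eqI lookup_coeff_tensor)

lemma coeff_tensor_diff: "coeff_tensor (c - d) g = coeff_tensor c g - coeff_tensor d g"
  by (simp add: poly_mapping_eqI lookup_coeff_tensor lookup_minus int_scale_diff_left)

lemma coeff_tensor_minus: "coeff_tensor (- c) g = - coeff_tensor c g"
  using coeff_tensor_diff[of 0 c g] by simp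

lemma coeff_tensor_add: "coeff_tensor (c + d) g = coeff_tensor c g + coeff_tensor d g"
  using coeff_tensor_diff[of c "- d" g] by (simp add: coeff_tensor_minus)

lemma coeff_tensor_sum: "coeff_tensor (\<Sum>i\<in>I. c i) g = (\<Sum>i\<in>I. coeff_tensor (c i) g)"
  by (induction I rule: infinite_finite_induct) (simp_all add: coeff_tensor_add)

lemma coeff_tensor_add_right: "coeff_tensor c (g + h) = coeff_tensor c g + coeff_tensor c h"
  by (simp add: poly_mapping_eqI lookup_coeff_tensor lookup_add int_scale_add)

lemma coeff_tensor_0_right [simp]: "coeff_tensor c 0 = 0"
  using coeff_tensor_add_right[of c 0 0] by simp

lemma coeff_tensor_frag_of [simp]: "coeff_tensor (frag_of f) g = Poly_Mapping.single f g"
  by (rule poly_mapping_eqI) (auto simp: lookup_coeff_tensor lookup_single)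

lemma keys_coeff_tensor: "Poly_Mapping.keys (coeff_tensor c g) \<subseteq> Poly_Mapping.keys c"
  by (auto simp: in_keys_iff lookup_coeff_tensor)

text \<open>The operator that an additive operator \<open>\<phi>\<close> on integral chains induces on chains with
  coefficients. Since this construction is functorial and additive, every identity between operators on
  integral chains carries over.\<close>

definition coeff_lift ::
    "('a chain \<Rightarrow> 'b chain) \<Rightarrow> ('a, 'g::ab_group_add) coeff_chain \<Rightarrow> ('b, 'g) coeff_chain" where
  "coeff_lift \<phi> C =
     (\<Sum>f\<in>Poly_Mapping.keys C. coeff_tensor (\<phi> (frag_of f)) (Poly_Mapping.lookup C f))"

lemma coeff_lift_superset:
  assumes "finite S" "Poly_Mapping.keys C \<subseteq> S"
  shows "coeff_lift \<phi> C = (\<Sum>f\<in>S. coeff_tensor (\<phi> (frag_of f)) (Poly_Mapping.lookup C f))"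
  unfolding coeff_lift_def
  by (rule sum.mono_neutral_left) (use assms in \<open>auto simp: in_keys_iff\<close>)

lemma coeff_lift_0 [simp]: "coeff_lift \<phi> 0 = 0"
  by (simp add: coeff_lift_def)

lemma coeff_lift_single [simp]:
  "coeff_lift \<phi> (Poly_Mapping.single f g) = coeff_tensor (\<phi> (frag_of f)) g"
  by (subst coeff_lift_superset[of "{f}"]) auto

lemma coeff_lift_add: "coeff_lift \<phi> (C + D) = coeff_lift \<phi> C + coeff_lift \<phi> D"
proof -
  let ?S = "Poly_Mapping.keys C \<union> Poly_Mapping.keys D"
  show ?thesis
    using Poly_Mapping.keys_add[of C D]
    by (simp add: coeff_lift_superset[of ?S] lookup_add coeff_tensor_add_right sum.distrib)
qed

lemma coeff_lift_minus: "coeff_lift \<phi> (- C) = - coeff_lift \<phi> C"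
  using coeff_lift_add[of \<phi> C "- C"] by (simp add: eq_neg_iff_add_eq_0 add.commute)

lemma coeff_lift_diff: "coeff_lift \<phi> (C - D) = coeff_lift \<phi> C - coeff_lift \<phi> D"
  using coeff_lift_add[of \<phi> C "- D"] by (simp add: coeff_lift_minus)

lemma coeff_lift_sum: "coeff_lift \<phi> (\<Sum>i\<in>I. D i) = (\<Sum>i\<in>I. coeff_lift \<phi> (D i))"
  by (induction I rule: infinite_finite_induct) (simp_all add: coeff_lift_add)

lemma coeff_chain_induct [consumes 1, case_names zero single add]:
  assumes "coeff_singular_chain p X C"
    and "P 0"
    and "\<And>f g. singular_simplex p X f \<Longrightarrow> P (Poly_Mapping.single f g)"
    and "\<And>C D. P C \<Longrightarrow> P D \<Longrightarrow> P (C + D)"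
  shows "P C"
proof -
  have "P (\<Sum>f\<in>S. Poly_Mapping.single f (Poly_Mapping.lookup C f))"
    if "S \<subseteq> Poly_Mapping.keys C" for S
    using that
    by (induction S rule: infinite_finite_induct)
       (use assms in \<open>auto simp: coeff_singular_chain_def subset_iff\<close>)
  moreover have "(\<Sum>f\<in>Poly_Mapping.keys C. Poly_Mapping.single f (Poly_Mapping.lookup C f)) = C"
    by (rule poly_mapping_eqI) (simp add: lookup_sum lookup_single when_def in_keys_iff)
  ultimately show ?thesis
    by (metis order_refl)
qed

lemma coeff_lift_tensor:
  assumes "\<And>c d. \<phi> (c - d) = \<phi> c - \<phi> d"
  shows "coeff_lift \<phi> (coeff_tensor c g) = coeff_tensor (\<phi> c) g"
proof -
  have zero: "\<phi> 0 = 0"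
    using assms[of 0 0] by simp
  have "Poly_Mapping.keys c \<subseteq> UNIV"
    by simp
  then show ?thesis
    by (induction c rule: frag_induction)
       (simp_all add: zero coeff_tensor_diff coeff_lift_diff assms)
qed

lemma coeff_lift_cong:
  assumes "coeff_singular_chain p X C"
    and "\<And>f. singular_simplex p X f \<Longrightarrow> \<phi> (frag_of f) = \<psi> (frag_of f)"
  shows "coeff_lift \<phi> C = coeff_lift \<psi> C"
  using assms(1)
  by (induction rule: coeff_chain_induct) (simp_all add: assms(2) coeff_lift_add)

lemma coeff_lift_lift:
  assumes "\<And>c d. \<phi> (c - d) = \<phi> c - \<phi> d"
  shows "coeff_lift \<phi> (coeff_lift \<psi> C) = coeff_lift (\<lambda>c. \<phi> (\<psi> c)) C"
  by (simp add: coeff_lift_sum coeff_lift_def[of \<psi>] coeff_lift_def[of "\<lambda>c. \<phi> (\<psi> c)"]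
      coeff_lift_tensor assms)

lemma coeff_lift_fun_diff:
  "coeff_lift (\<lambda>c. \<phi> c - \<psi> c) C = coeff_lift \<phi> C - coeff_lift \<psi> C"
  by (simp add: coeff_lift_def coeff_tensor_diff sum_subtractf)

lemma coeff_lift_fun_add:
  "coeff_lift (\<lambda>c. \<phi> c + \<psi> c) C = coeff_lift \<phi> C + coeff_lift \<psi> C"
  by (simp add: coeff_lift_def coeff_tensor_add sum.distrib)

lemma coeff_lift_frag_of:
  assumes "coeff_singular_chain p X C"
    and "\<And>f. singular_simplex p X f \<Longrightarrow> \<phi> (frag_of f) = frag_of f"
  shows "coeff_lift \<phi> C = C"
  using assms(1)
  by (induction rule: coeff_chain_induct) (simp_all add: assms(2) coeff_lift_add)

lemma coeff_singular_chain_lift: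
  assumes "coeff_singular_chain p X C"
    and "\<And>f. singular_simplex p X f \<Longrightarrow> singular_chain q Y (\<phi> (frag_of f))"
  shows "coeff_singular_chain q Y (coeff_lift \<phi> C)"
  using assms(1)
proof (induction rule: coeff_chain_induct)
  case (single f g)
  then show ?case
    using assms(2) keys_coeff_tensor[of "\<phi> (frag_of f)" g]
    by (auto simp: coeff_singular_chain_def singular_chain_def)
qed (simp_all add: coeff_lift_add coeff_singular_chain_add)

lemma keys_coeff_lift:
  "Poly_Mapping.keys (coeff_lift \<phi> C) \<subseteq> (\<Union>f\<in>Poly_Mapping.keys C. Poly_Mapping.keys (\<phi> (frag_of f)))"
proof -
  have "Poly_Mapping.keys (\<Sum>i\<in>I. D i) \<subseteq> (\<Union>i\<in>I. Poly_Mapping.keys (D i))"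
    for I :: "'i set" and D :: "'i \<Rightarrow> ('k \<Rightarrow>\<^sub>0 'h::comm_monoid_add)"
    by (induction I rule: infinite_finite_induct) (use Poly_Mapping.keys_add in fastforce)+
  from this[of "\<lambda>f. coeff_tensor (\<phi> (frag_of f)) (Poly_Mapping.lookup C f)" "Poly_Mapping.keys C"]
  show ?thesis
    unfolding coeff_lift_def using keys_coeff_tensor by blast
qed

text \<open>With this, identities that involve boundaries also transfer from integral chains.\<close>

lemma coeff_chain_boundary_lift: "coeff_chain_boundary p C = coeff_lift (chain_boundary p) C"
proof -
  have "coeff_simplex_boundary p f g = coeff_tensor (chain_boundary p (frag_of f)) g"
    for f :: "(nat \<Rightarrow> real) \<Rightarrow> 'a" and g :: 'b
  proof -
    have "frag_cmul ((-1) ^ k) (frag_of h) = (if even k then frag_of h else - frag_of h)"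
      for k and h :: "(nat \<Rightarrow> real) \<Rightarrow> 'a"
      by auto
    then show ?thesis
      by (auto simp: coeff_simplex_boundary_def chain_boundary_of coeff_tensor_sum coeff_tensor_minus
          single_uminus intro!: sum.cong)
  qed
  then show ?thesis
    by (simp add: coeff_chain_boundary_def coeff_lift_def)
qed

lemma coeff_singular_chain_chain_map:
  assumes "coeff_singular_chain p X C" "continuous_map X Y g"
  shows "coeff_singular_chain p Y (coeff_lift (chain_map p g) C)"
  using assms(1)
  by (rule coeff_singular_chain_lift)
     (simp add: singular_chain_of singular_simplex_simplex_map[OF _ assms(2)])

lemma coeff_chain_boundary_chain_map:
  assumes "coeff_singular_chain p X C"
  shows "coeff_chain_boundary p (coeff_lift (chain_map p g) C) =
         coeff_lift (chain_map (p - 1) g) (coeff_chain_boundary p C)"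
proof -
  have "coeff_lift (\<lambda>c. chain_boundary p (chain_map p g c)) C =
      coeff_lift (\<lambda>c. chain_map (p - 1) g (chain_boundary p c)) C"
    using assms by (rule coeff_lift_cong)
      (use chain_boundary_chain_map[of p X _ g] in \<open>simp add: singular_chain_of del: chain_map_of\<close>)
  then show ?thesis
    by (simp add: coeff_chain_boundary_lift coeff_lift_lift chain_boundary_diff chain_map_diff)
qed

lemma coeff_relboundary_chain_map:
  assumes "coeff_relboundary p X S c" and g: "continuous_map X Y g" "g ` S \<subseteq> T"
  shows "coeff_relboundary p Y T (coeff_lift (chain_map p g) c)"
proof -
  obtain d where d: "coeff_singular_chain (Suc p) X d"
    and dc: "coeff_singular_chain p (subtopology X S) (coeff_chain_boundary (Suc p) d - c)"
    using assms(1) unfolding coeff_relboundary_def by blast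
  have "continuous_map (subtopology X S) (subtopology Y T) g"
    using g continuous_map_from_subtopology[OF g(1)] by (auto simp: continuous_map_in_subtopology)
  with dc have sub: "coeff_singular_chain p (subtopology Y T)
      (coeff_lift (chain_map p g) (coeff_chain_boundary (Suc p) d - c))"
    by (rule coeff_singular_chain_chain_map)
  have "coeff_chain_boundary (Suc p) (coeff_lift (chain_map (Suc p) g) d) =
      coeff_lift (chain_map p g) (coeff_chain_boundary (Suc p) d)"
    using coeff_chain_boundary_chain_map[OF d, of g] by simp
  moreover have "coeff_singular_chain (Suc p) Y (coeff_lift (chain_map (Suc p) g) d)"
    using d g(1) by (rule coeff_singular_chain_chain_map)
  ultimately show ?thesis
    using sub unfolding coeff_relboundary_def by (metis coeff_lift_diff)
qed


section \<open>Excision with coefficients\<close>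

lemma coeff_chain_split:
  fixes C :: "('a, 'g::ab_group_add) coeff_chain"
  assumes "Poly_Mapping.keys C \<subseteq> S \<union> T"
  obtains D E where "C = D + E" "Poly_Mapping.keys D \<subseteq> S" "Poly_Mapping.keys E \<subseteq> T"
proof
  let ?D = "Poly_Mapping.mapp (\<lambda>f g. if f \<in> S then g else 0) C"
  show "C = ?D + (C - ?D)"
    by simp
  show "Poly_Mapping.keys ?D \<subseteq> S"
    by (auto simp: in_keys_iff lookup_mapp split: if_splits)
  show "Poly_Mapping.keys (C - ?D) \<subseteq> T"
    using assms by (auto simp: in_keys_iff lookup_mapp lookup_minus when_def split: if_splits)
qed

lemma coeff_singular_chain_subtopology_Int:
  assumes "coeff_singular_chain p (subtopology X S) C" "coeff_singular_chain p (subtopology X T) C"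
  shows "coeff_singular_chain p (subtopology X (S \<inter> T)) C"
  using assms by (auto simp: coeff_singular_chain_def singular_simplex_subtopology subset_iff)

lemma singular_chain_iterated_subdivision:
  "singular_chain p X c \<Longrightarrow> singular_chain p X ((singular_subdivision p ^^ m) c)"
  by (induction m) (simp_all add: singular_chain_singular_subdivision)

lemma chain_boundary_iterated_subdivision:
  assumes "singular_chain p X c"
  shows "chain_boundary p ((singular_subdivision p ^^ m) c) =
         (singular_subdivision (p - 1) ^^ m) (chain_boundary p c)"
proof (induction m)
  case (Suc m)
  then show ?case
    using chain_boundary_singular_subdivision[OF singular_chain_iterated_subdivision[OF assms]]
    by simp
qed simp

text \<open>Each of the finitely many simplices of the chain becomes small after some number of subdivisions and
  stays so afterwards; the largest of these numbers works for the whole chain.\<close>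

lemma small_iterated_subdivision_lift:
  assumes "\<And>U. U \<in> \<U> \<Longrightarrow> openin X U" "topspace X \<subseteq> \<Union>\<U>" "coeff_singular_chain p X C"
  obtains m where "\<And>f. f \<in> Poly_Mapping.keys (coeff_lift (singular_subdivision p ^^ m) C) \<Longrightarrow>
                       \<exists>U\<in>\<U>. f ` standard_simplex p \<subseteq> U"
proof -
  have "\<exists>N. \<forall>m\<ge>N. \<forall>h\<in>Poly_Mapping.keys ((singular_subdivision p ^^ m) (frag_of f)).
           \<exists>U\<in>\<U>. h ` standard_simplex p \<subseteq> U" if f: "f \<in> Poly_Mapping.keys C" for f
  proof -
    have "singular_chain p X (frag_of f)"
      using f assms(3) by (auto simp: coeff_singular_chain_def singular_chain_of)
    then obtain N where N: "\<And>m h. \<lbrakk>N \<le> m; h \<in> Poly_Mapping.keys ((singular_subdivision p ^^ m) (frag_of f))\<rbrakk>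
                      \<Longrightarrow> \<exists>V \<in> \<U>. h \<in> (standard_simplex p) \<rightarrow> V"
      using sufficient_iterated_singular_subdivision_exists[OF assms(1,2)] by metis
    show ?thesis
      unfolding image_subset_iff_funcset using N by blast
  qed
  then obtain N where N: "\<And>f m h. \<lbrakk>f \<in> Poly_Mapping.keys C; N f \<le> m;
      h \<in> Poly_Mapping.keys ((singular_subdivision p ^^ m) (frag_of f))\<rbrakk> \<Longrightarrow>
      \<exists>U\<in>\<U>. h ` standard_simplex p \<subseteq> U"
    by metis
  define m where "m = Max (N ` Poly_Mapping.keys C)"
  have m: "N f \<le> m" if "f \<in> Poly_Mapping.keys C" for f
    using that by (simp add: m_def)
  show thesis
  proof (rule that)
    fix h assume "h \<in> Poly_Mapping.keys (coeff_lift (singular_subdivision p ^^ m) C)"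
    then show "\<exists>U\<in>\<U>. h ` standard_simplex p \<subseteq> U"
      using keys_coeff_lift[of "singular_subdivision p ^^ m" C] N m by blast
  qed
qed

text \<open>After subdivision a chain \<open>e\<close> in \<open>U \<union> V\<close> splits into a part in \<open>U\<close> and a part in \<open>V\<close>. If \<open>\<partial>e\<close> is \<open>c\<close> up
  to a chain in \<open>B\<close>, the boundary of the first part differs from the subdivided \<open>c\<close> by a chain that
  lies both in \<open>U\<close> and in \<open>V \<union> B\<close>. The chain homotopy between subdivision and identity then leads back to \<open>c\<close>
  itself, at the cost of a chain in \<open>U \<inter> B\<close> coming from \<open>\<partial>c\<close>.\<close>

lemma coeff_relboundary_excision:
  fixes e c :: "('a, 'g::ab_group_add) coeff_chain"
  assumes U: "openin Y U" and V: "openin Y V"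
    and e: "coeff_singular_chain (Suc n) (subtopology Y (U \<union> V)) e"
    and c: "coeff_singular_chain n (subtopology Y U) c"
    and dc: "coeff_singular_chain (n - 1) (subtopology Y (U \<inter> B)) (coeff_chain_boundary n c)"
    and de: "coeff_singular_chain n (subtopology Y B) (coeff_chain_boundary (Suc n) e - c)"
  shows "coeff_relboundary n (subtopology Y U) (U \<inter> (V \<union> B)) c"
proof -
  have UV: "openin (subtopology Y (U \<union> V)) W" if "W \<in> {U, V}" for W
    using that U V by (auto simp: openin_subtopology)
  have top: "topspace (subtopology Y (U \<union> V)) \<subseteq> \<Union>{U, V}"
    by auto
  obtain m where small: "\<And>f. f \<in> Poly_Mapping.keys (coeff_lift (singular_subdivision (Suc n) ^^ m) e) \<Longrightarrow>
                       \<exists>W\<in>{U, V}. f ` standard_simplex (Suc n) \<subseteq> W"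
    using small_iterated_subdivision_lift[OF UV top e] by blast
  define sd :: "nat \<Rightarrow> 'a chain \<Rightarrow> 'a chain" where "sd p = singular_subdivision p ^^ m" for p
  have sd_diff: "sd p (a - b) = sd p a - sd p b" for p a b
    by (simp add: sd_def singular_subdivision_power_diff)
  have sd_chain: "coeff_singular_chain p X (coeff_lift (sd p) C)"
    if "coeff_singular_chain p X C" for p X and C :: "('a, 'g) coeff_chain"
    using that
    by (rule coeff_singular_chain_lift) (simp add: sd_def singular_chain_iterated_subdivision singular_chain_of)
  obtain h where h_diff: "\<And>p a b :: 'a chain. h p (a - b) = h p a - h p b"
    and h_chain: "\<And>p X c. singular_chain p X c \<Longrightarrow> singular_chain (Suc p) X (h p c)"
    and h: "\<And>p X c. singular_chain p X c \<Longrightarrow>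
        chain_boundary (Suc p) (h p c) + h (p - Suc 0) (chain_boundary p c) = sd p c - c"
    unfolding sd_def using chain_homotopic_iterated_singular_subdivision[where n = m] by metis
  have H_chain: "coeff_singular_chain (Suc p) X (coeff_lift (h p) C)"
    if "coeff_singular_chain p X C" for p X and C :: "('a, 'g) coeff_chain"
    using that by (rule coeff_singular_chain_lift) (simp add: h_chain singular_chain_of)
  have homotopy: "coeff_chain_boundary (Suc n) (coeff_lift (h n) c) +
      coeff_lift (h (n - 1)) (coeff_chain_boundary n c) = coeff_lift (sd n) c - c"
  proof -
    have "coeff_lift (\<lambda>c. chain_boundary (Suc n) (h n c) + h (n - 1) (chain_boundary n c)) c =
        coeff_lift (\<lambda>c. sd n c - c) c"
      using c by (rule coeff_lift_cong) (use h in \<open>simp add: singular_chain_of\<close>)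
    moreover have "coeff_lift (\<lambda>c. c) c = c"
      using c by (rule coeff_lift_frag_of) simp
    ultimately show ?thesis
      by (simp add: coeff_lift_fun_add coeff_lift_fun_diff coeff_chain_boundary_lift
          coeff_lift_lift h_diff chain_boundary_diff)
  qed
  define E where "E = coeff_lift (sd (Suc n)) e"
  have dE: "coeff_chain_boundary (Suc n) E = coeff_lift (sd n) (coeff_chain_boundary (Suc n) e)"
  proof -
    have "coeff_lift (\<lambda>c. chain_boundary (Suc n) (sd (Suc n) c)) e =
        coeff_lift (\<lambda>c. sd n (chain_boundary (Suc n) c)) e"
      using e
      by (rule coeff_lift_cong)
         (simp add: sd_def chain_boundary_iterated_subdivision[of _ "subtopology Y (U \<union> V)"] singular_chain_of)
    then show ?thesis
      by (simp add: E_def coeff_chain_boundary_lift coeff_lift_lift sd_diff chain_boundary_diff)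
  qed
  have "coeff_singular_chain (Suc n) Y E"
    using sd_chain[OF e] coeff_singular_chain_subtopology_imp E_def by blast
  then have E: "singular_simplex (Suc n) Y f" if "f \<in> Poly_Mapping.keys E" for f
    using that by (auto simp: coeff_singular_chain_def)
  have "Poly_Mapping.keys E \<subseteq> singular_simplex_set (Suc n) (subtopology Y U) \<union>
      singular_simplex_set (Suc n) (subtopology Y V)"
  proof
    fix f assume f: "f \<in> Poly_Mapping.keys E"
    then have "f ` standard_simplex (Suc n) \<subseteq> U \<or> f ` standard_simplex (Suc n) \<subseteq> V"
      using small[of f] by (simp add: E_def sd_def)
    then show "f \<in> singular_simplex_set (Suc n) (subtopology Y U) \<union>
        singular_simplex_set (Suc n) (subtopology Y V)"
      using E[OF f] by (simp add: singular_simplex_subtopology)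
  qed
  then obtain E1 E2 where split: "E = E1 + E2"
    and E1: "coeff_singular_chain (Suc n) (subtopology Y U) E1"
    and E2: "coeff_singular_chain (Suc n) (subtopology Y V) E2"
    using coeff_chain_split[of E] unfolding coeff_singular_chain_def by metis
  have diff: "coeff_chain_boundary (Suc n) E1 - coeff_lift (sd n) c =
      coeff_lift (sd n) (coeff_chain_boundary (Suc n) e - c) - coeff_chain_boundary (Suc n) E2"
    using dE by (simp add: split coeff_chain_boundary_add coeff_lift_diff algebra_simps)
  have inU: "coeff_singular_chain n (subtopology Y U)
      (coeff_chain_boundary (Suc n) E1 - coeff_lift (sd n) c)"
    using coeff_singular_chain_boundary[OF E1] sd_chain[OF c]
    by (simp add: coeff_singular_chain_diff)
  have "coeff_singular_chain n (subtopology Y (V \<union> B))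
      (coeff_chain_boundary (Suc n) E1 - coeff_lift (sd n) c)"
    unfolding diff
  proof (rule coeff_singular_chain_diff)
    show "coeff_singular_chain n (subtopology Y (V \<union> B))
        (coeff_lift (sd n) (coeff_chain_boundary (Suc n) e - c))"
      using sd_chain[OF de] by (rule coeff_singular_chain_mono) blast
    show "coeff_singular_chain n (subtopology Y (V \<union> B)) (coeff_chain_boundary (Suc n) E2)"
      using coeff_singular_chain_boundary[OF E2] coeff_singular_chain_mono[of n Y V _ "V \<union> B"] by simp
  qed
  with inU have near: "coeff_singular_chain n (subtopology Y (U \<inter> (V \<union> B)))
      (coeff_chain_boundary (Suc n) E1 - coeff_lift (sd n) c)"
    by (rule coeff_singular_chain_subtopology_Int)
  have far: "coeff_singular_chain n (subtopology Y (U \<inter> (V \<union> B)))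
      (coeff_lift (h (n - 1)) (coeff_chain_boundary n c))"
  proof (cases "n = 0")
    case True
    \<comment> \<open>The predecessor of \<open>0\<close> is \<open>0\<close>, so the degrees do not match here, but \<open>\<partial>c\<close> vanishes.\<close>
    then show ?thesis
      by (simp add: coeff_chain_boundary_def coeff_simplex_boundary_def)
  next
    case False
    then show ?thesis
      using coeff_singular_chain_mono[OF H_chain[OF dc], of "U \<inter> (V \<union> B)"] by auto
  qed
  have "coeff_chain_boundary (Suc n) (E1 - coeff_lift (h n) c) - c =
      (coeff_chain_boundary (Suc n) E1 - coeff_lift (sd n) c) +
      coeff_lift (h (n - 1)) (coeff_chain_boundary n c)"
    using homotopy by (simp add: coeff_chain_boundary_diff algebra_simps)
  moreover have "coeff_singular_chain (Suc n) (subtopology Y U) (E1 - coeff_lift (h n) c)"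
    using E1 H_chain[OF c] by (rule coeff_singular_chain_diff)
  moreover have "U \<inter> (U \<inter> (V \<union> B)) = U \<inter> (V \<union> B)"
    by blast
  ultimately show ?thesis
    unfolding coeff_relboundary_def subtopology_subtopology
    using coeff_singular_chain_add[OF near far] by metis
qed


section \<open>Height and base point in the cone\<close>

lemma topspace_cylinder [simp]: "topspace (cylinder X) = topspace X \<times> {0..1}"
  by (simp add: cylinder_def)

lemma topspace_cone: "topspace (cone X) = cone_proj X ` (topspace X \<times> {0..1})"
  using quotient_imp_surjective_map[OF quotient_map_cone_proj, of X] by simp

lemma cone_cases:
  assumes "z \<in> topspace (cone X)"
  obtains x t where "x \<in> topspace X" "0 \<le> t" "t \<le> 1" "z = cone_proj X (x, t)"
  using assms by (auto simp: topspace_cone)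

definition cone_level :: "('a \<times> real) set \<Rightarrow> real" where
  "cone_level z = snd (SOME w. w \<in> z)"

text \<open>For the tip this is an arbitrary point of the base.\<close>

definition cone_point :: "('a \<times> real) set \<Rightarrow> 'a" where
  "cone_point z = fst (SOME w. w \<in> z)"

lemma cone_level_proj [simp]: "x \<in> topspace X \<Longrightarrow> cone_level (cone_proj X (x, t)) = t"
proof -
  assume "x \<in> topspace X"
  then have "(SOME w. w \<in> topspace X \<times> {0::real}) \<in> topspace X \<times> {0}"
    by (intro someI[of "\<lambda>w. w \<in> topspace X \<times> {0}" "(x, 0)"]) simp
  then show ?thesis
    by (auto simp: cone_level_def cone_proj_def)
qed

lemma cone_point_proj [simp]: "t \<noteq> 0 \<Longrightarrow> cone_point (cone_proj X (x, t)) = x"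
  by (simp add: cone_point_def cone_proj_def)

lemma continuous_map_cone_level: "continuous_map (cone X) euclideanreal cone_level"
proof (rule continuous_compose_quotient_map[OF quotient_map_cone_proj])
  have "continuous_map (cylinder X) (top_of_set {0..1}) snd"
    unfolding cylinder_def by (rule continuous_map_snd)
  then have "continuous_map (cylinder X) euclideanreal snd"
    by (rule continuous_map_into_fulltopology)
  then show "continuous_map (cylinder X) euclideanreal (cone_level \<circ> cone_proj X)"
    by (rule continuous_map_eq) auto
qed

lemma openin_cone_level:
  assumes "open S"
  shows "openin (cone X) {z \<in> topspace (cone X). cone_level z \<in> S}"
  using openin_continuous_map_preimage[OF continuous_map_cone_level, of S] assms by simp

lemma continuous_map_cone_point:
  "continuous_map (subtopology (cone X) {z \<in> topspace (cone X). 0 < cone_level z}) X cone_point"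
proof -
  let ?P = "{z \<in> topspace (cone X). 0 < cone_level z}"
    and ?Q = "{w \<in> topspace (cylinder X). 0 < snd w}"
  have "openin (cone X) ?P"
    using openin_cone_level[of "{0<..}" X] by simp
  moreover have "{w \<in> topspace (cylinder X). cone_proj X w \<in> ?P} = ?Q"
    by (auto simp: topspace_cone)
  ultimately have q: "quotient_map (subtopology (cylinder X) ?Q) (subtopology (cone X) ?P) (cone_proj X)"
    by (intro quotient_map_restriction[OF quotient_map_cone_proj]) auto
  have "continuous_map (cylinder X) X fst"
    unfolding cylinder_def by (rule continuous_map_fst)
  then have "continuous_map (subtopology (cylinder X) ?Q) X fst"
    by (rule continuous_map_from_subtopology)
  then have "continuous_map (subtopology (cylinder X) ?Q) X (cone_point \<circ> cone_proj X)"
    by (rule continuous_map_eq) auto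
  then show ?thesis
    by (rule continuous_compose_quotient_map[OF q])
qed

lemma continuous_map_cone_slice:
  assumes "t \<in> {0..1}"
  shows "continuous_map X (cone X) (\<lambda>x. cone_proj X (x, t))"
proof -
  have "continuous_map X (cylinder X) (\<lambda>x. (x, t))"
    using assms unfolding cylinder_def by (intro continuous_map_pairedI) auto
  from continuous_map_compose[OF this quotient_imp_continuous_map[OF quotient_map_cone_proj]]
  show ?thesis
    by (simp add: o_def)
qed

lemma openin_cone_point:
  assumes "openin X S"
  shows "openin (cone X) {z \<in> topspace (cone X). 0 < cone_level z \<and> cone_point z \<in> S}"
proof -
  let ?P = "{z \<in> topspace (cone X). 0 < cone_level z}"
  have "openin (cone X) ?P"
    using openin_cone_level[of "{0<..}" X] by simp
  moreover have "openin (subtopology (cone X) ?P) {z \<in> topspace (subtopology (cone X) ?P). cone_point z \<in> S}"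
    using openin_continuous_map_preimage[OF continuous_map_cone_point assms] .
  ultimately have "openin (cone X) {z \<in> topspace (subtopology (cone X) ?P). cone_point z \<in> S}"
    using openin_trans_full by blast
  moreover have "{z \<in> topspace (subtopology (cone X) ?P). cone_point z \<in> S} =
      {z \<in> topspace (cone X). 0 < cone_level z \<and> cone_point z \<in> S}"
    by auto
  ultimately show ?thesis
    by simp
qed

lemma compact_space_cone: "compact_space X \<Longrightarrow> compact_space (cone X)"
proof -
  assume "compact_space X"
  then have "compact_space (cylinder X)"
    by (simp add: cylinder_def compact_space_prod_topology compact_space_subtopology)
  then have "compactin (cone X) (cone_proj X ` topspace (cylinder X))"
    using image_compactin quotient_imp_continuous_map[OF quotient_map_cone_proj]
    unfolding compact_space_def by blast
  then show ?thesis
    by (simp add: compact_space_def topspace_cone)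
qed

text \<open>Points at different levels are separated by the level, points at the same positive level by their
  projections to the base.\<close>

lemma Hausdorff_space_cone:
  assumes "Hausdorff_space X"
  shows "Hausdorff_space (cone X)"
  unfolding Hausdorff_space_def
proof (intro allI impI)
  fix z w
  assume zw: "z \<in> topspace (cone X) \<and> w \<in> topspace (cone X) \<and> z \<noteq> w"
  then have "z \<in> topspace (cone X)" "w \<in> topspace (cone X)"
    by auto
  then obtain x s y t where z: "x \<in> topspace X" "z = cone_proj X (x, s)" "0 \<le> s"
    and w: "y \<in> topspace X" "w = cone_proj X (y, t)"
    by (elim cone_cases)
  show "\<exists>U V. openin (cone X) U \<and> openin (cone X) V \<and> z \<in> U \<and> w \<in> V \<and> disjnt U V"
  proof (cases "s = t")
    case False
    then obtain S T where "open S" "open T" "s \<in> S" "t \<in> T" "S \<inter> T = {}"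
      by (metis separation_t2)
    then show ?thesis
      using zw z w
      by (intro exI[of _ "{z \<in> topspace (cone X). cone_level z \<in> S}"]
          exI[of _ "{z \<in> topspace (cone X). cone_level z \<in> T}"])
         (auto simp: openin_cone_level disjnt_iff)
  next
    case True
    then have "s \<noteq> 0" "x \<noteq> y"
      using zw z w by (auto simp: cone_proj_def)
    then obtain S T where "openin X S" "openin X T" "x \<in> S" "y \<in> T" "disjnt S T"
      using assms z w unfolding Hausdorff_space_def by blast
    then show ?thesis
      using zw z w True \<open>s \<noteq> 0\<close>
      by (intro exI[of _ "{z \<in> topspace (cone X). 0 < cone_level z \<and> cone_point z \<in> S}"]
          exI[of _ "{z \<in> topspace (cone X). 0 < cone_level z \<and> cone_point z \<in> T}"])
         (auto simp: openin_cone_point disjnt_iff)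
  qed
qed

text \<open>Along the segment from the tip through a point of the cone, the levels strictly between \<open>0\<close> and \<open>1\<close> are
  dense.\<close>

lemma open_in_cone_meets_interior_level:
  assumes W: "openin (cone X) W" "z \<in> W"
  obtains x t where "x \<in> topspace X" "0 < t" "t < 1" "cone_proj X (x, t) \<in> W"
proof -
  obtain x s where x: "x \<in> topspace X" and s: "0 \<le> s" "s \<le> 1" and z: "z = cone_proj X (x, s)"
    using W openin_subset cone_cases by (metis subsetD)
  have "continuous_map (top_of_set {0..1}) (cylinder X) (\<lambda>t. (x, t))"
    unfolding cylinder_def using x by (intro continuous_map_pairedI) auto
  from continuous_map_compose[OF this quotient_imp_continuous_map[OF quotient_map_cone_proj]]
  have "continuous_map (top_of_set {0..1}) (cone X) (\<lambda>t. cone_proj X (x, t))"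
    by (simp add: o_def)
  from openin_continuous_map_preimage[OF this W(1)]
  obtain T where T: "open T" "{t \<in> {0..1}. cone_proj X (x, t) \<in> W} = {0..1} \<inter> T"
    by (auto simp: openin_open)
  have "s \<in> T"
    using T(2) s W(2) z by auto
  moreover have "s \<in> closure {0<..<1}"
    using s by simp
  ultimately obtain t where "t \<in> T" "0 < t" "t < 1"
    using open_Int_closure_eq_empty[OF T(1), of "{0<..<1}"] by fastforce
  moreover from this have "cone_proj X (x, t) \<in> W"
    using T(2) by force
  ultimately show thesis
    using that x by blast
qed


section \<open>Coning singular simplices\<close>

text \<open>The cone over a simplex \<open>f\<close> with the new vertex \<open>0\<close> sent to the tip. At that vertex the
  argument of \<open>f\<close> is a division by zero, which is harmless as \<open>cone_proj\<close> forgets the base point there.\<close>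

definition cone_simplex ::
    "'a topology \<Rightarrow> nat \<Rightarrow> ((nat \<Rightarrow> real) \<Rightarrow> 'a) \<Rightarrow> (nat \<Rightarrow> real) \<Rightarrow> ('a \<times> real) set" where
  "cone_simplex X p f =
     (\<lambda>t\<in>standard_simplex (Suc p). cone_proj X (f (\<lambda>i. t (Suc i) / (1 - t 0)), 1 - t 0))"

definition cone_chain :: "'a topology \<Rightarrow> nat \<Rightarrow> 'a chain \<Rightarrow> ('a \<times> real) set chain" where
  "cone_chain X p = frag_extend (frag_of \<circ> cone_simplex X p)"

lemma cone_proj_0: "cone_proj X (x, 0) = cone_proj X (y, 0)"
  by (simp add: cone_proj_def)

lemma standard_simplex_opposite_face:
  assumes t: "t \<in> standard_simplex (Suc p)" and "t 0 \<noteq> 1"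
  shows "(\<lambda>i. t (Suc i) / (1 - t 0)) \<in> standard_simplex p"
proof -
  have pos: "0 < 1 - t 0"
    using assms by (simp add: standard_simplex_def) (metis less_eq_real_def)
  have nonneg: "0 \<le> t i" for i
    using t by (simp add: standard_simplex_def)
  have sum: "(\<Sum>i\<le>p. t (Suc i)) = 1 - t 0"
    using t by (simp add: standard_simplex_def sum.atMost_Suc_shift del: sum.atMost_Suc)
  have "t (Suc i) \<le> 1 - t 0" for i
  proof (cases "i \<le> p")
    case True
    then have "t (Suc i) \<le> (\<Sum>i\<le>p. t (Suc i))"
      by (intro member_le_sum) (use nonneg in auto)
    then show ?thesis
      by (simp add: sum)
  next
    case False
    then show ?thesis
      using t pos by (simp add: standard_simplex_def)
  qed
  then show ?thesis
    using pos nonneg sum t by (simp add: standard_simplex_def flip: sum_divide_distrib)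
qed

text \<open>Parametrizing the simplex by its join structure turns the coned simplex into the product of \<open>f\<close>
  with an interval, followed by the projection of the cylinder. This parametrization is a quotient map, being
  a continuous surjection from a compact space to a Hausdorff space.\<close>

lemma singular_simplex_cone_simplex:
  assumes f: "singular_simplex p X f"
  shows "singular_simplex (Suc p) (cone X) (cone_simplex X p f)"
proof -
  define D where "D q = subtopology (powertop_real UNIV) (standard_simplex q)" for q
  let ?I = "top_of_set {0..1::real}"
  define J :: "(nat \<Rightarrow> real) \<times> real \<Rightarrow> nat \<Rightarrow> real"
    where "J = (\<lambda>(u, s) i. case i of 0 \<Rightarrow> 1 - s | Suc j \<Rightarrow> s * u j)"
  have top_D: "topspace (D q) = standard_simplex q" for q
    by (simp add: D_def)
  have J_in: "J w \<in> standard_simplex (Suc p)" if w_in: "w \<in> standard_simplex p \<times> {0..1}" for w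
  proof -
    obtain u s where w: "w = (u, s)" and u: "u \<in> standard_simplex p" and s: "0 \<le> s" "s \<le> 1"
      using w_in by auto
    have "(\<Sum>i\<le>Suc p. J w i) = J w 0 + (\<Sum>i\<le>p. J w (Suc i))"
      by (rule sum.atMost_Suc_shift)
    also have "\<dots> = 1 - s + s * (\<Sum>i\<le>p. u i)"
      by (simp add: J_def w sum_distrib_left)
    also have "\<dots> = 1"
      using u by (simp add: standard_simplex_def)
    finally have "(\<Sum>i\<le>Suc p. J w i) = 1" .
    moreover have "0 \<le> J w i \<and> J w i \<le> 1" for i
      using u s by (cases i) (simp_all add: J_def w standard_simplex_def mult_le_one)
    moreover have "J w i = 0" if "i > Suc p" for i
      using u that by (cases i) (simp_all add: J_def w standard_simplex_def)
    ultimately show ?thesis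
      by (simp add: standard_simplex_def del: sum.atMost_Suc)
  qed
  have coords: "continuous_map (prod_topology (D p) ?I) euclideanreal (\<lambda>w. fst w i)"
    "continuous_map (prod_topology (D p) ?I) euclideanreal snd" for i
  proof -
    have "continuous_map (D p) euclideanreal (\<lambda>u. u i)"
      unfolding D_def by (intro continuous_map_from_subtopology continuous_map_product_projection) auto
    from continuous_map_compose[OF continuous_map_fst this]
    show "continuous_map (prod_topology (D p) ?I) euclideanreal (\<lambda>w. fst w i)"
      by (simp add: o_def)
    show "continuous_map (prod_topology (D p) ?I) euclideanreal snd"
      using continuous_map_snd by (rule continuous_map_into_fulltopology)
  qed
  have "continuous_map (prod_topology (D p) ?I) euclideanreal (\<lambda>w. J w i)" for i
    by (cases i) (use coords in \<open>auto simp: J_def case_prod_beta intro!: continuous_map_diff continuous_map_real_mult\<close>)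
  then have J_cont: "continuous_map (prod_topology (D p) ?I) (D (Suc p)) J"
    using J_in
    by (auto simp: D_def[of "Suc p"] continuous_map_in_subtopology continuous_map_componentwise_UNIV top_D)
  have J_onto: "J ` (standard_simplex p \<times> {0..1}) = standard_simplex (Suc p)"
  proof (intro equalityI subsetI)
    fix t assume t: "t \<in> standard_simplex (Suc p)"
    show "t \<in> J ` (standard_simplex p \<times> {0..1})"
    proof (cases "t 0 = 1")
      case True
      have "t i = 0" if "i \<noteq> 0" for i
      proof (cases "i \<le> Suc p")
        case le: True
        have "(\<Sum>i\<le>p. t (Suc i)) = 0"
          using t True by (simp add: standard_simplex_def sum.atMost_Suc_shift del: sum.atMost_Suc)
        then have "\<forall>j\<le>p. t (Suc j) = 0"
          using t by (subst (asm) sum_nonneg_eq_0_iff) (auto simp: standard_simplex_def)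
        then show ?thesis
          using that le by (cases i) auto
      next
        case False
        then show ?thesis
          using t by (simp add: standard_simplex_def)
      qed
      then have "t = J (u, 0)" for u
        using True by (auto simp: J_def fun_eq_iff split: nat.split)
      then show ?thesis
        using nonempty_standard_simplex[of p] by fastforce
    next
      case False
      have "t = J (\<lambda>i. t (Suc i) / (1 - t 0), 1 - t 0)"
        using False by (auto simp: J_def fun_eq_iff split: nat.split)
      moreover have "1 - t 0 \<in> {0..1}"
        using t by (simp add: standard_simplex_def)
      ultimately show ?thesis
        using standard_simplex_opposite_face[OF t False] by blast
    qed
  qed (use J_in in blast)
  have "compact_space (D p)"
    unfolding D_def by (rule compact_space_subtopology[OF compactin_standard_simplex])
  then have "compact_space (prod_topology (D p) ?I)"
    by (simp add: compact_space_prod_topology compact_space_subtopology)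
  moreover have "Hausdorff_space (D (Suc p))"
    unfolding D_def
    by (intro Hausdorff_space_subtopology) (simp add: Hausdorff_space_product_topology)
  ultimately have "closed_map (prod_topology (D p) ?I) (D (Suc p)) J"
    using J_cont continuous_imp_closed_map by blast
  then have quot: "quotient_map (prod_topology (D p) ?I) (D (Suc p)) J"
    using J_cont J_onto by (intro continuous_closed_imp_quotient_map) (auto simp: top_D)
  have "continuous_map (D p) X f"
    using f by (simp add: singular_simplex_def D_def)
  then have "continuous_map (prod_topology (D p) ?I) (cylinder X) (\<lambda>w. (f (fst w), snd w))"
    unfolding cylinder_def
    by (intro continuous_map_pairedI continuous_map_snd continuous_map_compose[OF continuous_map_fst, unfolded o_def])
  then have "continuous_map (prod_topology (D p) ?I) (cone X) (\<lambda>w. cone_proj X (f (fst w), snd w))"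
    using continuous_map_compose[OF _ quotient_imp_continuous_map[OF quotient_map_cone_proj],
        of _ _ "\<lambda>w. (f (fst w), snd w)"]
    by (simp add: o_def)
  then have "continuous_map (prod_topology (D p) ?I) (cone X) (cone_simplex X p f \<circ> J)"
  proof (rule continuous_map_eq)
    fix w assume w: "w \<in> topspace (prod_topology (D p) ?I)"
    obtain u s where us: "w = (u, s)"
      by fastforce
    have "J w \<in> standard_simplex (Suc p)" "J w 0 = 1 - s" "\<And>i. J w (Suc i) = s * u i"
      using J_in[of w] w by (simp_all add: top_D us J_def)
    then have cone: "(cone_simplex X p f \<circ> J) w = cone_proj X (f (\<lambda>i. s * u i / s), s)"
      by (simp add: cone_simplex_def)
    show "cone_proj X (f (fst w), snd w) = (cone_simplex X p f \<circ> J) w"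
    proof (cases "s = 0")
      case True
      then show ?thesis
        unfolding cone using cone_proj_0[of X "f u" "f (\<lambda>i. s * u i / s)"] by (simp add: us)
    next
      case False
      then show ?thesis
        unfolding cone by (simp add: us)
    qed
  qed
  from continuous_compose_quotient_map[OF quot this] show ?thesis
    by (simp add: singular_simplex_def D_def cone_simplex_def)
qed

text \<open>At the cone vertex the base point may be replaced by any value of \<open>f\<close>, which puts the tip into the
  subcone.\<close>

lemma singular_simplex_cone_simplex_subcone:
  assumes "singular_simplex p (subtopology X A) f"
  shows "singular_simplex (Suc p) (subtopology (cone X) (subcone X A)) (cone_simplex X p f)"
proof -
  have f: "singular_simplex p X f" "f ` standard_simplex p \<subseteq> A"
    using assms by (auto simp: singular_simplex_subtopology)
  have "cone_simplex X p f t \<in> subcone X A" if t: "t \<in> standard_simplex (Suc p)" for t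
  proof -
    have level: "1 - t 0 \<in> {0..1}"
      using t by (simp add: standard_simplex_def)
    obtain a where a: "a \<in> A" "cone_simplex X p f t = cone_proj X (a, 1 - t 0)"
    proof (cases "t 0 = 1")
      case True
      obtain u where "u \<in> standard_simplex p"
        using nonempty_standard_simplex by blast
      moreover have "cone_simplex X p f t = cone_proj X (f u, 1 - t 0)"
        using t True cone_proj_0[of X _ "f u"] by (simp add: cone_simplex_def)
      ultimately show thesis
        using that f(2) by blast
    next
      case False
      then show thesis
        using that f(2) t standard_simplex_opposite_face[OF t False] by (auto simp: cone_simplex_def)
    qed
    then show ?thesis
      using level by (auto simp: subcone_def)
  qed
  then show ?thesis
    using singular_simplex_cone_simplex[OF f(1)] by (auto simp: singular_simplex_subtopology)
qed

lemma cone_chain_diff: "cone_chain X p (c - d) = cone_chain X p c - cone_chain X p d"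
  by (simp add: cone_chain_def frag_extend_diff)

lemma cone_chain_of [simp]: "cone_chain X p (frag_of f) = frag_of (cone_simplex X p f)"
  by (simp add: cone_chain_def)

text \<open>The face opposite the cone vertex is the given simplex on the base; every other face is the cone over a
  face.\<close>

lemma chain_boundary_cone_simplex:
  assumes f: "singular_simplex p X f" and p: "p \<ge> 1"
  shows "chain_boundary (Suc p) (frag_of (cone_simplex X p f)) =
         chain_map p (\<lambda>x. cone_proj X (x, 1)) (frag_of f) -
         cone_chain X (p - 1) (chain_boundary p (frag_of f))"
proof -
  have base: "singular_face (Suc p) 0 (cone_simplex X p f) = simplex_map p (\<lambda>x. cone_proj X (x, 1)) f"
  proof
    fix t :: "nat \<Rightarrow> real"
    have "(\<lambda>i. simplical_face 0 t (Suc i) / (1 - simplical_face 0 t 0)) = t" "simplical_face 0 t 0 = 0"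
      by (simp_all add: simplical_face_def)
    then show "singular_face (Suc p) 0 (cone_simplex X p f) t = simplex_map p (\<lambda>x. cone_proj X (x, 1)) f t"
      using simplical_face_in_standard_simplex[of "Suc p" 0 t]
      by (simp add: singular_face_def simplex_map_def cone_simplex_def)
  qed
  have sides: "singular_face (Suc p) (Suc k) (cone_simplex X p f) =
      cone_simplex X (p - 1) (singular_face p k f)" if k: "k \<le> p" for k
  proof
    fix t :: "nat \<Rightarrow> real"
    show "singular_face (Suc p) (Suc k) (cone_simplex X p f) t =
        cone_simplex X (p - 1) (singular_face p k f) t"
    proof (cases "t \<in> standard_simplex p")
      case True
      define u where "u = (\<lambda>i. t (Suc i) / (1 - t 0))"
      have "simplical_face (Suc k) t \<in> standard_simplex (Suc p)"
        using simplical_face_in_standard_simplex[of "Suc p" "Suc k" t] True k by simp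
      moreover have "(\<lambda>i. simplical_face (Suc k) t (Suc i) / (1 - simplical_face (Suc k) t 0)) =
          simplical_face k u"
        using p by (auto simp: simplical_face_def u_def fun_eq_iff)
      moreover have "simplical_face (Suc k) t 0 = t 0"
        by (simp add: simplical_face_def)
      ultimately have lhs: "singular_face (Suc p) (Suc k) (cone_simplex X p f) t =
          cone_proj X (f (simplical_face k u), 1 - t 0)"
        using True by (simp add: singular_face_def cone_simplex_def)
      have rhs: "cone_simplex X (p - 1) (singular_face p k f) t =
          cone_proj X (singular_face p k f u, 1 - t 0)"
        using True p by (simp add: cone_simplex_def u_def)
      show ?thesis
      proof (cases "t 0 = 1")
        case True
        then show ?thesis
          unfolding lhs rhs by simp (rule cone_proj_0)
      next
        case False
        then have "u \<in> standard_simplex (p - 1)"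
          using standard_simplex_opposite_face[of t "p - 1"] \<open>t \<in> standard_simplex p\<close> p by (simp add: u_def)
        then show ?thesis
          unfolding lhs rhs by (simp add: singular_face_def)
      qed
    qed (use p in \<open>simp add: singular_face_def cone_simplex_def\<close>)
  qed
  have "chain_boundary (Suc p) (frag_of (cone_simplex X p f)) =
      frag_of (singular_face (Suc p) 0 (cone_simplex X p f)) +
      (\<Sum>k\<le>p. frag_cmul ((-1) ^ Suc k) (frag_of (singular_face (Suc p) (Suc k) (cone_simplex X p f))))"
    by (simp add: chain_boundary_of sum.atMost_Suc_shift del: sum.atMost_Suc)
  moreover have "(\<Sum>k\<le>p. frag_cmul ((-1) ^ Suc k) (frag_of (singular_face (Suc p) (Suc k) (cone_simplex X p f)))) =
      (\<Sum>k\<le>p. - cone_chain X (p - 1) (frag_cmul ((-1) ^ k) (frag_of (singular_face p k f))))"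
    using sides by (intro sum.cong) (simp_all add: cone_chain_def frag_extend_cmul)
  moreover have "cone_chain X (p - 1) (chain_boundary p (frag_of f)) =
        (\<Sum>k\<le>p. cone_chain X (p - 1) (frag_cmul ((-1) ^ k) (frag_of (singular_face p k f))))"
    using p by (simp add: chain_boundary_of cone_chain_def frag_extend_sum o_def)
  ultimately show ?thesis
    by (simp only: base chain_map_of sum_negf diff_conv_add_uminus)
qed

lemma coeff_chain_boundary_cone:
  fixes c :: "('a, 'g::ab_group_add) coeff_chain"
  assumes "coeff_singular_chain n X c" "n \<ge> 1"
  shows "coeff_chain_boundary (Suc n) (coeff_lift (cone_chain X n) c) =
         coeff_lift (chain_map n (\<lambda>x. cone_proj X (x, 1))) c -
         coeff_lift (cone_chain X (n - 1)) (coeff_chain_boundary n c)"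
proof -
  have "coeff_lift (\<lambda>c. chain_boundary (Suc n) (cone_chain X n c)) c =
      coeff_lift (\<lambda>c. chain_map n (\<lambda>x. cone_proj X (x, 1)) c - cone_chain X (n - 1) (chain_boundary n c)) c"
    using assms(1)
    by (rule coeff_lift_cong) (simp only: cone_chain_of chain_boundary_cone_simplex[OF _ assms(2)])
  then show ?thesis
    by (simp add: coeff_chain_boundary_lift coeff_lift_lift coeff_lift_fun_diff chain_boundary_diff cone_chain_diff)
qed


section \<open>Small regular cells\<close>

lemma Euclidean_space_box_subset:
  assumes "openin (Euclidean_space n) S" and u: "u \<in> S"
  obtains r where "r > 0" "{v \<in> topspace (Euclidean_space n). \<forall>i. \<bar>v i - u i\<bar> \<le> r} \<subseteq> S"
proof -
  obtain S' where S': "openin (powertop_real UNIV) S'" "S = S' \<inter> topspace (Euclidean_space n)"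
    using assms(1) by (auto simp: Euclidean_space_def openin_subtopology)
  with u obtain W where fin: "finite {i. W i \<noteq> UNIV}" and op: "\<And>i. open (W i)"
    and uW: "u \<in> Pi\<^sub>E UNIV W" and WS: "Pi\<^sub>E UNIV W \<subseteq> S'"
    unfolding openin_product_topology_alt by fastforce
  have "\<exists>e>0. \<forall>y. \<bar>y - u i\<bar> \<le> e \<longrightarrow> y \<in> W i" for i
  proof -
    have "u i \<in> W i"
      using uW by auto
    then obtain e where "e > 0" "cball (u i) e \<subseteq> W i"
      using op open_contains_cball by blast
    then show ?thesis
      by (intro exI[of _ e]) (auto simp: subset_iff dist_real_def abs_minus_commute)
  qed
  then obtain e where e: "\<And>i. e i > 0" "\<And>i y. \<bar>y - u i\<bar> \<le> e i \<Longrightarrow> y \<in> W i"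
    by metis
  define r where "r = Min (insert 1 (e ` {i. W i \<noteq> UNIV}))"
  have r: "r > 0" "\<And>i. W i \<noteq> UNIV \<Longrightarrow> r \<le> e i"
    using fin e(1) by (auto simp: r_def)
  show thesis
  proof (rule that[OF r(1)], clarify)
    fix v assume v: "v \<in> topspace (Euclidean_space n)" "\<forall>i. \<bar>v i - u i\<bar> \<le> r"
    have "v i \<in> W i" for i
    proof (cases "W i = UNIV")
      case False
      then show ?thesis
        using e(2)[of "v i" i] v(2)[rule_format, of i] r(2)[of i] by auto
    qed simp
    then show "v \<in> S"
      using WS v(1) by (auto simp: S'(2))
  qed
qed

lemma homeomorphic_map_Euclidean_space_affine:
  assumes u: "u \<in> topspace (Euclidean_space n)" and r: "r \<noteq> 0"
  shows "homeomorphic_map (Euclidean_space n) (Euclidean_space n) (\<lambda>v i. u i + r * v i)"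
proof -
  have proj: "continuous_map (Euclidean_space n) euclideanreal (\<lambda>v. v i)" for i
    unfolding Euclidean_space_def
    by (intro continuous_map_from_subtopology continuous_map_product_projection) auto
  have aff: "continuous_map (Euclidean_space n) (Euclidean_space n) (\<lambda>v i. a i + b * v i)"
    if a: "a \<in> topspace (Euclidean_space n)" for a b
  proof -
    have "continuous_map (Euclidean_space n) euclideanreal (\<lambda>v. a i + b * v i)" for i
      by (intro continuous_map_add continuous_map_real_mult proj) auto
    then show ?thesis
      using a
      by (subst (2) Euclidean_space_def)
         (auto simp: continuous_map_in_subtopology continuous_map_componentwise_UNIV topspace_Euclidean_space)
  qed
  have "homeomorphic_maps (Euclidean_space n) (Euclidean_space n)
      (\<lambda>v i. u i + r * v i) (\<lambda>v i. - u i / r + 1 / r * v i)"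
    unfolding homeomorphic_maps_def
  proof (intro conjI ballI)
    show "continuous_map (Euclidean_space n) (Euclidean_space n) (\<lambda>v i. u i + r * v i)"
      by (rule aff[OF u])
    show "continuous_map (Euclidean_space n) (Euclidean_space n) (\<lambda>v i. - u i / r + 1 / r * v i)"
      by (rule aff) (use u in \<open>simp add: topspace_Euclidean_space\<close>)
  qed (use r in \<open>auto simp: fun_eq_iff field_simps\<close>)
  then show ?thesis
    by (rule homeomorphic_maps_imp_map)
qed

text \<open>Rescaling a chart about a point maps the unit ball into any given neighbourhood of that point.\<close>

lemma regular_cell_in_neighbourhood:
  assumes "n_Euclidean_point n Y x" and V: "openin Y V" "x \<in> V"
  obtains C where "regular_n_cell n Y C" "x \<in> C" "C \<subseteq> V"
proof -
  let ?E = "Euclidean_space n"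
  obtain U where n: "n \<ge> 1" and U: "openin Y U" "x \<in> U"
    and "subtopology Y U homeomorphic_space ?E"
    using assms(1) by (auto simp: n_Euclidean_point_def)
  then obtain h where h: "homeomorphic_map ?E (subtopology Y U) h"
    using homeomorphic_space homeomorphic_space_sym by blast
  have top_U: "topspace (subtopology Y U) = U"
    using U openin_subset by fastforce
  have "h ` topspace ?E = U"
    using homeomorphic_imp_surjective_map[OF h] unfolding top_U .
  then obtain u where u: "u \<in> topspace ?E" "h u = x"
    using U by blast
  have "openin (subtopology Y U) (U \<inter> V)"
    using V by (auto simp: openin_subtopology)
  then have op: "openin ?E {v \<in> topspace ?E. h v \<in> U \<inter> V}"
    by (rule openin_continuous_map_preimage[OF homeomorphic_imp_continuous_map[OF h]])
  have in_op: "u \<in> {v \<in> topspace ?E. h v \<in> U \<inter> V}"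
    using u U V by simp
  obtain r where r: "r > 0"
    and box: "{v \<in> topspace ?E. \<forall>i. \<bar>v i - u i\<bar> \<le> r} \<subseteq> {v \<in> topspace ?E. h v \<in> U \<inter> V}"
    by (rule Euclidean_space_box_subset[OF op in_op])
  define f where "f = h \<circ> (\<lambda>v i. u i + r * v i)"
  have f: "homeomorphic_map ?E (subtopology Y U) f"
    unfolding f_def
    by (rule homeomorphic_map_compose[OF homeomorphic_map_Euclidean_space_affine[OF u(1)] h]) (use r in simp)
  define C where "C = f ` topspace (unit_ball n)"
  have ball: "topspace (unit_ball n) = {v \<in> topspace ?E. (\<Sum>i<n. (v i)\<^sup>2) \<le> 1}"
    by (auto simp: unit_ball_def)
  have CU: "C \<subseteq> U"
    using homeomorphic_imp_surjective_map[OF f] by (auto simp: C_def ball top_U)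
  have CV: "C \<subseteq> V"
  proof
    fix y assume "y \<in> C"
    then obtain v where v: "v \<in> topspace ?E" "(\<Sum>i<n. (v i)\<^sup>2) \<le> 1" and y: "y = h (\<lambda>i. u i + r * v i)"
      by (auto simp: C_def ball f_def)
    have "\<bar>v i\<bar> \<le> 1" for i
    proof (cases "i < n")
      case True
      then have "(v i)\<^sup>2 \<le> (\<Sum>i<n. (v i)\<^sup>2)"
        by (intro member_le_sum) auto
      then show ?thesis
        using v(2) abs_square_le_1[of "v i"] by linarith
    next
      case False
      then show ?thesis
        using v(1) by (simp add: topspace_Euclidean_space)
    qed
    then have "\<bar>(u i + r * v i) - u i\<bar> \<le> r" for i
      using r by (simp add: abs_mult mult_left_le)
    moreover have "(\<lambda>i. u i + r * v i) \<in> topspace ?E"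
      using u(1) v(1) by (simp add: topspace_Euclidean_space)
    ultimately have "(\<lambda>i. u i + r * v i) \<in> {v \<in> topspace ?E. h v \<in> U \<inter> V}"
      by (intro subsetD[OF box]) simp
    then show "y \<in> V"
      by (simp add: y)
  qed
  have "(\<lambda>i. 0) \<in> topspace (unit_ball n)"
    by (simp add: ball topspace_Euclidean_space)
  moreover have "f (\<lambda>i. 0) = x"
    using u by (simp add: f_def)
  ultimately have xC: "x \<in> C"
    unfolding C_def by force
  have "homeomorphic_map (unit_ball n) (subtopology (subtopology Y U) C) f"
    unfolding unit_ball_def
  proof (rule homeomorphic_map_subtopologies[OF f])
    show "f ` (topspace ?E \<inter> {v. (\<Sum>i<n. (v i)\<^sup>2) \<le> 1}) = topspace (subtopology Y U) \<inter> C"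
      unfolding top_U using CU by (auto simp: C_def ball)
  qed
  moreover have "U \<inter> C = C"
    using CU by blast
  ultimately have "homeomorphic_map (unit_ball n) (subtopology Y C) f"
    by (simp add: subtopology_subtopology)
  moreover have "openin Y (f ` open_unit_ball n)"
    using homeomorphic_imp_open_map[OF f] openin_open_unit_ball[OF n] openin_trans_full[OF _ U(1)]
    unfolding open_map_def by blast
  ultimately have "regular_n_cell n Y C"
    using n CU openin_subset[OF U(1)] by (auto simp: regular_n_cell_def regular_cell_map_def)
  then show thesis
    using that xC CV by blast
qed

lemma regular_n_cell_open_subspace:
  assumes "openin X S" "regular_n_cell n (subtopology X S) C"
  shows "regular_n_cell n X C"
proof -
  have C: "C \<subseteq> topspace X" "C \<subseteq> S"
    using assms(2) by (auto simp: regular_n_cell_def)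
  then have "S \<inter> C = C"
    by blast
  then show ?thesis
    using assms C openin_trans_full[OF _ assms(1)]
    by (auto simp: regular_n_cell_def regular_cell_map_def subtopology_subtopology)
qed

lemma compactin_regular_n_cell:
  assumes "regular_n_cell n X C"
  shows "compactin X C"
proof -
  obtain f where C: "C \<subseteq> topspace X" and f: "homeomorphic_map (unit_ball n) (subtopology X C) f"
    using assms by (auto simp: regular_n_cell_def regular_cell_map_def)
  have "compact_space (unit_ball n)"
  proof -
    let ?B = "{x :: nat \<Rightarrow> real. (\<forall>i\<ge>n. x i = 0) \<and> (\<Sum>i<n. (x i)\<^sup>2) \<le> 1}"
    have "closed ?B"
      by (intro closed_Collect_conj closed_Collect_all closed_Collect_imp closed_Collect_eq
          closed_Collect_le open_Collect_const continuous_intros continuous_on_product_coordinates)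
    then have "closedin (powertop_real UNIV) ?B"
      by (simp add: euclidean_product_topology)
    moreover have "?B \<subseteq> UNIV \<rightarrow>\<^sub>E {-1..1}"
    proof
      fix x assume x: "x \<in> ?B"
      have "\<bar>x i\<bar> \<le> 1" for i
      proof (cases "i < n")
        case True
        then have "(x i)\<^sup>2 \<le> (\<Sum>i<n. (x i)\<^sup>2)"
          by (intro member_le_sum) auto
        moreover have "(\<Sum>i<n. (x i)\<^sup>2) \<le> 1"
          using x by simp
        ultimately show ?thesis
          using abs_square_le_1[of "x i"] by linarith
      qed (use x in simp)
      then show "x \<in> UNIV \<rightarrow>\<^sub>E {-1..1}"
        by (simp add: PiE_UNIV_domain Pi_iff abs_le_iff minus_le_iff)
    qed
    moreover have "compactin (powertop_real UNIV) (UNIV \<rightarrow>\<^sub>E {-1..1::real})"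
      by (simp add: compactin_PiE)
    ultimately have "compactin (powertop_real UNIV) ?B"
      using closed_compactin by blast
    moreover have "unit_ball n = subtopology (powertop_real UNIV) ?B"
      by (simp add: unit_ball_def Euclidean_space_def subtopology_subtopology Collect_conj_eq)
    ultimately show ?thesis
      by (simp add: compact_space_subtopology)
  qed
  then have "compact_space (subtopology X C)"
    using homeomorphic_compact_space f homeomorphic_space by blast
  then show ?thesis
    using C by (simp add: compactin_subspace)
qed

lemma open_cell_subset:
  assumes "regular_n_cell n X C"
  shows "open_cell n X C \<subseteq> C"
proof -
  obtain f where n: "n \<ge> 1" and C: "C \<subseteq> topspace X" and f: "regular_cell_map n X C f"
    using assms by (auto simp: regular_n_cell_def)
  then have "homeomorphic_map (unit_ball n) (subtopology X C) f"
    by (simp add: regular_cell_map_def)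
  from homeomorphic_imp_surjective_map[OF this]
  have "f ` topspace (unit_ball n) \<subseteq> C"
    by simp
  moreover have "open_unit_ball n \<subseteq> topspace (unit_ball n)"
    by (auto simp: open_unit_ball_def)
  ultimately show ?thesis
    unfolding open_cell_eq[OF n f] by blast
qed


section \<open>The surjection property\<close>

text \<open>If the image of \<open>f\<close> misses \<open>C \<times> {t}\<close>, every relative cycle bounds away from \<open>C\<close>: the cone over it,
  mapped by \<open>f\<close>, is a chain in the complement of \<open>C \<times> {t}\<close> that can be cut at level \<open>t\<close>, and the upper part
  projects to \<open>X\<close>.\<close>

lemma coeff_relboundary_of_cone_map:
  fixes c :: "('a, 'g::ab_group_add) coeff_chain"
  assumes f: "continuous_map (cone X) (cone X) f"
    and base: "\<And>z. z \<in> cone_base X \<Longrightarrow> f z = z"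
    and sub: "f ` subcone X A \<subseteq> subcone X A" and A: "A \<subseteq> topspace X"
    and t: "0 < t" "t < 1" and C: "closedin X C" "C \<inter> A = {}"
    and avoid: "\<And>x. x \<in> C \<Longrightarrow> cone_proj X (x, t) \<notin> f ` topspace (cone X)"
    and n: "n \<ge> 1" and c: "coeff_relcycle n X A c"
  shows "coeff_relboundary n X (topspace X - C) c"
proof -
  \<comment> \<open>A point of level \<open>t\<close> outside \<open>U\<close> lies in \<open>C \<times> {t}\<close>, and a point of \<open>U\<close> below level \<open>t\<close> projects
    outside \<open>C\<close>.\<close>
  define Z where "Z = cone X"
  define B where "B = subcone X A"
  define \<iota> where "\<iota> = (\<lambda>x. cone_proj X (x, 1))"
  define U where "U = {z \<in> topspace Z. cone_level z \<in> {t<..}} \<union>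
      {z \<in> topspace Z. 0 < cone_level z \<and> cone_point z \<in> topspace X - C}"
  define V where "V = {z \<in> topspace Z. cone_level z \<in> {..<t}}"
  have UV: "openin Z U" "openin Z V"
  proof -
    show "openin Z U"
      using C(1) unfolding U_def Z_def
      by (intro openin_Un openin_cone_level openin_cone_point openin_diff openin_topspace open_greaterThan)
    show "openin Z V"
      unfolding V_def Z_def by (intro openin_cone_level open_lessThan)
  qed
  have c_chain: "coeff_singular_chain n X c"
    and dc_chain: "coeff_singular_chain (n - 1) (subtopology X A) (coeff_chain_boundary n c)"
    using c by (auto simp: coeff_relcycle_def)
  have base_in: "\<iota> x \<in> topspace Z" "f (\<iota> x) = \<iota> x" if "x \<in> topspace X" for x
    using that base by (auto simp: \<iota>_def Z_def topspace_cone cone_base_def)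
  have \<iota>: "continuous_map X Z \<iota>"
    unfolding \<iota>_def Z_def by (rule continuous_map_cone_slice) simp
  have \<iota>U: "\<iota> x \<in> U" if "x \<in> topspace X" for x
    using that t base_in[OF that] by (simp add: U_def) (simp add: \<iota>_def)
  have fUV: "continuous_map Z (subtopology Z (U \<union> V)) f"
  proof -
    have "f z \<in> U \<union> V" if "z \<in> topspace Z" for z
    proof -
      have fz: "f z \<in> topspace Z" "f z \<in> f ` topspace (cone X)"
        using f that by (auto simp: continuous_map_def Z_def)
      then obtain x s where "x \<in> topspace X" "0 \<le> s" and eq: "f z = cone_proj X (x, s)"
        unfolding Z_def by (elim cone_cases)
      then show ?thesis
        using fz avoid[of x] t by (cases "s = t") (auto simp: U_def V_def)
    qed
    then show ?thesis
      using f by (auto simp: continuous_map_in_subtopology Z_def)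
  qed
  have fB: "continuous_map (subtopology Z B) (subtopology Z B) f"
    using f sub unfolding B_def Z_def
    by (auto simp: continuous_map_in_subtopology continuous_map_from_subtopology)
  \<comment> \<open>\<open>e\<close> is the image under \<open>f\<close> of the cone over \<open>c\<close>, and \<open>c'\<close> is \<open>c\<close> placed on the base.\<close>
  define e where "e = coeff_lift (chain_map (Suc n) f) (coeff_lift (cone_chain X n) c)"
  define c' where "c' = coeff_lift (chain_map n \<iota>) c"
  have cone_c: "coeff_singular_chain (Suc n) Z (coeff_lift (cone_chain X n) c)"
    using c_chain unfolding Z_def
    by (rule coeff_singular_chain_lift) (simp add: singular_chain_of singular_simplex_cone_simplex)
  have e: "coeff_singular_chain (Suc n) (subtopology Z (U \<union> V)) e"
    unfolding e_def using cone_c fUV by (rule coeff_singular_chain_chain_map)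
  have c': "coeff_singular_chain n (subtopology Z U) c'"
    unfolding c'_def using c_chain
    by (rule coeff_singular_chain_chain_map) (use \<iota> \<iota>U in \<open>auto simp: continuous_map_in_subtopology\<close>)
  have dc': "coeff_singular_chain (n - 1) (subtopology Z (U \<inter> B)) (coeff_chain_boundary n c')"
  proof -
    have "continuous_map (subtopology X A) (subtopology Z (U \<inter> B)) \<iota>"
      using continuous_map_from_subtopology[OF \<iota>] \<iota>U A
      by (auto simp: continuous_map_in_subtopology B_def subcone_def \<iota>_def)
    from coeff_singular_chain_chain_map[OF dc_chain this] show ?thesis
      unfolding c'_def by (simp add: coeff_chain_boundary_chain_map[OF c_chain])
  qed
  have "coeff_chain_boundary (Suc n) e = coeff_lift (chain_map n f) c' -
      coeff_lift (chain_map n f) (coeff_lift (cone_chain X (n - 1)) (coeff_chain_boundary n c))"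
    unfolding e_def c'_def \<iota>_def
    by (simp only: coeff_chain_boundary_chain_map[OF cone_c] diff_Suc_1
        coeff_chain_boundary_cone[OF c_chain n] coeff_lift_diff)
  moreover have "coeff_lift (chain_map n f) c' = c'"
  proof -
    have "coeff_lift (chain_map n f) c' = coeff_lift (\<lambda>c. chain_map n f (chain_map n \<iota> c)) c"
      unfolding c'_def by (rule coeff_lift_lift) (rule chain_map_diff)
    also have "\<dots> = c'"
      unfolding c'_def using c_chain
    proof (rule coeff_lift_cong)
      fix g assume g: "singular_simplex n X g"
      have "chain_map n f (chain_map n \<iota> (frag_of g)) = chain_map n (f \<circ> \<iota>) (frag_of g)"
        by (simp only: chain_map_compose o_apply)
      also have "\<dots> = chain_map n \<iota> (frag_of g)"
        by (rule chain_map_eq[of n X]) (use g base_in in \<open>simp_all add: singular_chain_of\<close>)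
      finally show "chain_map n f (chain_map n \<iota> (frag_of g)) = chain_map n \<iota> (frag_of g)" .
    qed
    finally show ?thesis .
  qed
  moreover have "coeff_singular_chain n (subtopology Z B)
      (coeff_lift (chain_map n f) (coeff_lift (cone_chain X (n - 1)) (coeff_chain_boundary n c)))"
  proof (rule coeff_singular_chain_chain_map[OF _ fB])
    show "coeff_singular_chain n (subtopology Z B)
        (coeff_lift (cone_chain X (n - 1)) (coeff_chain_boundary n c))"
      using dc_chain
    proof (rule coeff_singular_chain_lift)
      fix g assume "singular_simplex (n - 1) (subtopology X A) g"
      from singular_simplex_cone_simplex_subcone[OF this]
      show "singular_chain n (subtopology Z B) (cone_chain X (n - 1) (frag_of g))"
        using n by (simp add: singular_chain_of Z_def B_def)
    qed
  qed
  ultimately have de: "coeff_singular_chain n (subtopology Z B) (coeff_chain_boundary (Suc n) e - c')"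
    by (simp add: coeff_singular_chain_minus)
  have "coeff_relboundary n (subtopology Z U) (U \<inter> (V \<union> B)) c'"
    by (rule coeff_relboundary_excision[OF UV e c' dc' de])
  moreover have "continuous_map (subtopology Z U) X cone_point"
  proof -
    have "U \<subseteq> {z \<in> topspace (cone X). 0 < cone_level z}"
      using t by (auto simp: U_def Z_def)
    then show ?thesis
      unfolding Z_def by (rule continuous_map_from_subtopology_mono[OF continuous_map_cone_point])
  qed
  moreover have "cone_point ` (U \<inter> (V \<union> B)) \<subseteq> topspace X - C"
  proof
    fix y assume "y \<in> cone_point ` (U \<inter> (V \<union> B))"
    then obtain z where z: "z \<in> U" "z \<in> V \<or> z \<in> B" and y: "y = cone_point z"
      by auto
    from z(2) show "y \<in> topspace X - C"
    proof
      assume "z \<in> V"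
      then show ?thesis
        using z(1) by (auto simp: U_def V_def y)
    next
      assume "z \<in> B"
      then obtain a s where a: "a \<in> A" "z = cone_proj X (a, s)"
        by (auto simp: B_def subcone_def)
      then have aX: "a \<in> topspace X"
        using A by blast
      have "0 < cone_level z"
        using z(1) t by (auto simp: U_def)
      then have "y = a"
        using aX by (simp add: y a)
      then show ?thesis
        using a aX C(2) by blast
    qed
  qed
  ultimately have "coeff_relboundary n X (topspace X - C) (coeff_lift (chain_map n cone_point) c')"
    by (rule coeff_relboundary_chain_map)
  moreover have "coeff_lift (chain_map n cone_point) c' = c"
  proof -
    have "coeff_lift (chain_map n cone_point) c' =
        coeff_lift (\<lambda>c. chain_map n cone_point (chain_map n \<iota> c)) c"
      unfolding c'_def by (rule coeff_lift_lift) (rule chain_map_diff)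
    also have "\<dots> = c"
      using c_chain
    proof (rule coeff_lift_frag_of)
      fix g assume g: "singular_simplex n X g"
      have "chain_map n cone_point (chain_map n \<iota> (frag_of g)) = chain_map n (cone_point \<circ> \<iota>) (frag_of g)"
        by (simp only: chain_map_compose o_apply)
      also have "\<dots> = frag_of g"
        by (rule chain_map_id_gen[of n X]) (use g in \<open>simp_all add: singular_chain_of \<iota>_def\<close>)
      finally show "chain_map n cone_point (chain_map n \<iota> (frag_of g)) = frag_of g" .
    qed
    finally show ?thesis .
  qed
  ultimately show ?thesis
    by simp
qed

lemma belongs_to_relative_cycleE:
  assumes "belongs_to_relative_cycle n X A C" and "A \<subseteq> topspace X - open_cell n X C"
  obtains c :: "('a, circle_group) coeff_chain"
  where "coeff_relcycle n X A c" "\<not> coeff_relboundary n X (topspace X - open_cell n X C) c"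
proof -
  let ?B = "topspace X - open_cell n X C"
  obtain K :: "('a, circle_group) coeff_chain set" where K: "K \<in> carrier (coeff_relative_homology_group n X A)"
    and nontriv: "coeff_hom_inclusion n X A ?B K \<noteq> \<one>\<^bsub>coeff_relative_homology_group n X ?B\<^esub>"
    using assms(1) by (auto simp: belongs_to_relative_cycle_def Let_def)
  obtain c where c: "coeff_relcycle n X A c"
    and Kc: "K = Collect (coeff_relboundary n X A) #>\<^bsub>coeff_relcycle_group n X A\<^esub> c"
    using K by (auto simp: carrier_coeff_relative_homology_group)
  have "\<not> coeff_relboundary n X ?B c"
  proof
    assume b: "coeff_relboundary n X ?B c"
    have "coeff_relboundary n X ?B (d - c) \<longleftrightarrow> coeff_relboundary n X ?B d" for d
      using coeff_relboundary_add[OF _ b, of "d - c"]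
        coeff_relboundary_add[OF _ coeff_relboundary_minus[OF b], of d] by auto
    moreover have "coeff_hom_inclusion n X A ?B K =
        Collect (coeff_relboundary n X ?B) #>\<^bsub>coeff_relcycle_group n X ?B\<^esub> c"
      unfolding Kc by (rule coeff_hom_inclusion_class[OF assms(2)])
    ultimately have "coeff_hom_inclusion n X A ?B K = Collect (coeff_relboundary n X ?B)"
      by (simp add: coeff_relboundary_coset)
    then show False
      using nontriv by (simp add: coeff_relative_homology_group_def FactGroup_def)
  qed
  with c show thesis
    by (rule that)
qed

theorem corollary4p3:
  fixes X :: "'a topology" and A :: "'a set"
  assumes "compact_pair X A"
    and "almost_Euclidean_pair X A"
    and "\<And>n C. regular_n_cell n X C \<Longrightarrow> C \<subseteq> topspace X - A \<Longrightarrow> belongs_to_relative_cycle n X A C"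
  shows "surjection_property (cone_pair X A)"
  unfolding surjection_property_def cone_pair_def prod.case
proof (intro allI impI)
  fix f
  assume "continuous_map (cone X) (cone X) f \<and> (\<forall>z\<in>cone_base X \<union> subcone X A. f z = z)"
  then have f: "continuous_map (cone X) (cone X) f"
    and fix_base: "\<And>z. z \<in> cone_base X \<Longrightarrow> f z = z" and fix_sub: "\<And>z. z \<in> subcone X A \<Longrightarrow> f z = z"
    by auto
  have compX: "compact_space X" and hausX: "Hausdorff_space X" and compA: "compactin X A"
    using assms(1) by (auto simp: compact_pair_def metrizable_imp_Hausdorff_space)
  have A: "A \<subseteq> topspace X" "closedin X A"
    using compA hausX by (auto simp: compactin_subset_topspace compactin_imp_closedin)
  have f_in: "f ` topspace (cone X) \<subseteq> topspace (cone X)"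
    using f by (auto simp: continuous_map_def)
  show "f ` topspace (cone X) = topspace (cone X)"
  proof (rule ccontr)
    define W where "W = topspace (cone X) - f ` topspace (cone X)"
    assume "f ` topspace (cone X) \<noteq> topspace (cone X)"
    then obtain z where z: "z \<in> W"
      using f_in by (auto simp: W_def)
    have "compactin (cone X) (f ` topspace (cone X))"
      using image_compactin[OF _ f] compact_space_cone[OF compX] by (simp add: compact_space_def)
    then have W: "openin (cone X) W"
      unfolding W_def
      by (intro openin_diff openin_topspace compactin_imp_closedin Hausdorff_space_cone hausX)
    obtain x t where x: "x \<in> topspace X" "cone_proj X (x, t) \<in> W" and t: "0 < t" "t < 1"
      using open_in_cone_meets_interior_level[OF W z] by metis
    define Y where "Y = subtopology X (topspace X - A)"
    have openY: "openin X (topspace X - A)"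
      using A by blast
    define P where "P = {y \<in> topspace X. cone_proj X (y, t) \<in> W}"
    have "openin X P"
      unfolding P_def using t
      by (intro openin_continuous_map_preimage[OF continuous_map_cone_slice W]) auto
    moreover have PA: "P \<inter> A = {}"
    proof -
      have "cone_proj X (a, t) \<notin> W" if "a \<in> A" for a
      proof -
        have "cone_proj X (a, t) \<in> subcone X A"
          using that t by (auto simp: subcone_def)
        moreover have "cone_proj X (a, t) \<in> topspace (cone X)"
          using that t A(1) by (auto simp: topspace_cone)
        ultimately show ?thesis
          unfolding W_def using fix_sub by (metis DiffD2 imageI)
      qed
      then show ?thesis
        by (auto simp: P_def)
    qed
    ultimately have P: "openin Y P"
      using openin_subset[of X P] by (auto simp: Y_def openin_open_subtopology[OF openY])
    have "x \<in> P"
      using x by (simp add: P_def)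
    moreover have "x \<in> Y closure_of {y \<in> topspace Y. Euclidean_point Y y}"
      using assms(2) \<open>x \<in> P\<close> openin_subset[OF P]
      by (auto simp: almost_Euclidean_pair_def almost_Euclidean_space_def Y_def)
    ultimately obtain y where "y \<in> P" "Euclidean_point Y y"
      using P by (auto simp: in_closure_of)
    then obtain n where n: "n \<ge> 1" "n_Euclidean_point n Y y"
      by (auto simp: Euclidean_point_def)
    then obtain C where C: "regular_n_cell n Y C" "C \<subseteq> P"
      using regular_cell_in_neighbourhood[OF _ P \<open>y \<in> P\<close>] by metis
    then have cell: "regular_n_cell n X C"
      using regular_n_cell_open_subspace[OF openY] by (simp add: Y_def)
    have CA: "C \<subseteq> topspace X - A"
      using C(2) PA by (auto simp: P_def)
    have "A \<subseteq> topspace X - open_cell n X C"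
      using open_cell_subset[OF cell] CA A(1) by blast
    then obtain c :: "('a, circle_group) coeff_chain" where c: "coeff_relcycle n X A c"
      and nontriv: "\<not> coeff_relboundary n X (topspace X - open_cell n X C) c"
      using belongs_to_relative_cycleE[OF assms(3)[OF cell CA]] by blast
    have "coeff_relboundary n X (topspace X - C) c"
    proof (rule coeff_relboundary_of_cone_map[OF f fix_base _ A(1) t _ _ _ n(1) c])
      show "f ` subcone X A \<subseteq> subcone X A"
        using fix_sub by auto
      show "closedin X C"
        using compactin_imp_closedin[OF hausX compactin_regular_n_cell[OF cell]] .
      show "C \<inter> A = {}"
        using CA by blast
      show "cone_proj X (x, t) \<notin> f ` topspace (cone X)" if "x \<in> C" for x
        using that C(2) by (auto simp: P_def W_def)
    qed
    then have "coeff_relboundary n X (topspace X - open_cell n X C) c"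
      by (rule coeff_relboundary_mono) (use open_cell_subset[OF cell] in blast)
    with nontriv show False
      by blast
  qed
qed

end
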